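(* Let $c$ and $a_1,a_2,\dots$ be positive real numbers such that $ca_i<1$ for all $i$ and $a_ia_j<1$ for all $i\neq j$, and let $G(n,m)$ be the half-space last passage time with geometric weights of parameters $a_na_m$ (off the diagonal) and $ca_n$ (on the diagonal). Let $0<i_1<i_2<\dots<i_n$ and $j_1>j_2>\dots>j_n\geq 0$ be integers such that $i_k>j_k$ for all $k$. Then we have the equality in law $$\big(G(i_1,j_1),\dots,G(i_n,j_n)\big)\overset{(d)}{=}\big(\lambda^{(1)}_1,\dots,\lambda^{(n)}_1\big),$$ where the sequence of partitions $\lambda^{(1)},\dots,\lambda^{(n)}$ is distributed according to the Pfaffian Schur process $\mathbf{PSP}(\rho_0^+;\rho_1^+;\dots;\rho_{n-1}^+\,|\,\rho_1^-;\dots;\rho_n^-)$ with $$\rho_0^+=(c,a_{j_1+1},\dots,a_{i_1}),\qquad \rho_k^+=(a_{i_k+1},\dots,a_{i_{k+1}})\ \ (1\leq k\leq n-1),$$ $$\rho_k^-=(a_{j_{k+1}+1},\dots,a_{j_k})\ \ (1\leq k\leq n-1),\qquad \rho_n^-=(a_1,\dots,a_{j_n}).$$ Equivalently, in terms of zig-zag paths, $$\big(G(i_1,j_1),\dots,G(i_n,j_n)\big)\overset{(d)}{=}\big(\lambda_1^{(i_1,j_1)},\dots,\lambda_1^{(i_n,j_n)}\big),$$ where the sequence of partitions $\lambda^{(i_1,j_1)},\dots,\lambda^{(i_n,j_n)}$ is distributed according to the (marginal at these vertices of the) Pfaffian Schur process indexed by a path $\gamma\in\Omega$ going through the points $(i_1,j_1),\dots,(i_n,j_n)$,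 where each vertical edge with vertical coordinates $i-1$ and $i$, and each horizontal edge with horizontal coordinates $i-1$ and $i$, is labelled by the specialization into the single variable $a_i$, and the diagonal edge is labelled by the specialization into the variable $c$.
   Context: Half-space geometric LPP. Let $(g_{n,m})_{n\geq m\geq0}$ be independent geometric random variables ($X\sim\mathrm{Geom}(q)$ means $\mathbb{P}(X=k)=(1-q)q^k$, $k\in\mathbb{Z}_{\geq0}$), with parameter $a_na_m$ when $n\geq m+1$ and $ca_n$ when $n=m$. For $n\geq m\geq1$, $G(n,m)=g_{n,m}+\max\{G(n-1,m),G(n,m-1)\}$ if $n\geq m+1$, and $G(n,n)=g_{n,n}+G(n,n-1)$, with $G(n,0)=0$. Schur functions. $s_{\lambda/\mu}$ are skew Schur functions ($s_{\lambda/\mu}=0$ if $\mu\not\subset\lambda$); $s_{\lambda/\mu}(\rho)$, for a finite list $\rho$ of nonnegative reals, is the evaluation at these variables. $\lambda'$ denotes the conjugate partition; a partition is even if all its parts are even. Set $\tau_\lambda=\sum_{\kappa:\,\kappa'\text{ even}}s_{\lambda/\kappa}$. Pfaffian Schur process. $\mathbf{PSP}(\rho_0^+;\dots;\rho_{n-1}^+|\rho_1^-;\dots;\rho_n^-)$ is the probability measure on sequences of partitions $\varnothing\subset\lambda^{(1)}\supset\mu^{(1)}\subset\lambda^{(2)}\supset\mu^{(2)}\cdots\mu^{(n-1)}\subset\lambda^{(n)}\supset\varnothing$ with probability proportional to $$\tau_{\lambda^{(1)}}(\rho_0^+)\,s_{\lambda^{(1)}/\mu^{(1)}}(\rho_1^-)\,s_{\lambda^{(2)}/\mu^{(1)}}(\rho_1^+)\cdots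 s_{\lambda^{(n)}/\mu^{(n-1)}}(\rho_{n-1}^+)\,s_{\lambda^{(n)}}(\rho_n^-).$$ Zig-zag version. $\Omega$ is the set of oriented paths starting on the horizontal axis at $(+\infty,0)$, proceeding by unit steps to the left or upwards in $\mathbb{Z}_{\geq0}^2$, hitting the diagonal at some point $(N,N)$, $N>0$, and then taking one final (diagonal) edge to $(0,0)$. Each edge $e$ is labelled by a specialization $\rho_e$, the diagonal edge being labelled by $\rho_\circ$, and each vertex $v$ carries a partition $\lambda^v$, with $\lambda^v=\varnothing$ on the horizontal axis. The Pfaffian Schur process indexed by $\gamma\in\Omega$ is the probability measure on $(\lambda^v)_{v\in\gamma}$ with probability proportional to $\tau_{\lambda^{(N,N)}}(\rho_\circ)\prod_e\mathcal{W}(e)$, the product running over horizontal and vertical edges, where a horizontal edge $e$ from $u$ (right) to $v$ (left) has $\mathcal{W}(e)=s_{\lambda^u/\lambda^v}(\rho_e)$ (so $\lambda^v\subset\lambda^u$), and a vertical edge $e$ from $u$ (bottom) to $v$ (top) has $\mathcal{W}(e)=s_{\lambda^v/\lambda^u}(\rho_e)$, with the following convention: edges on the horizontal axis carry weight $1$ (empty specializations). Note that, with the stated ordering, in the horizontal/vertical weights the partition at the point further to the right on a horizontal edge contains the one at the left, and the partition at the upper end of a vertical edge contains the one at the lower end. *)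

theory Defs
  imports "HOL-Probability.Probability"
begin

section \<open>Half-space geometric last passage percolation\<close>

text \<open>The library's geometric distribution is parametrised by the success probability:
  \<open>pmf (Geom q) k = (1 - q) * q ^ k\<close> for \<open>0 \<le> q < 1\<close>.\<close>

definition Geom :: "real \<Rightarrow> nat pmf" where
  "Geom q = geometric_pmf (1 - q)"

text \<open>\<open>half_space_LPP w n m\<close> is the passage time \<open>G(n,m)\<close> for the weights \<open>w\<close>; the value for
  \<open>n < m\<close> is a dummy that is never reached from \<open>n \<ge> m\<close>.\<close>

fun half_space_LPP :: "(nat \<times> nat \<Rightarrow> nat) \<Rightarrow> nat \<Rightarrow> nat \<Rightarrow> nat" where
  "half_space_LPP w n 0 = 0"
| "half_space_LPP w n (Suc m) =
    (if n > Suc m then w (n, Suc m) + max (half_space_LPP w (n - 1) (Suc m)) (half_space_LPP w n m)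
     else if n = Suc m then w (n, n) + half_space_LPP w n m
     else 0)"

declare half_space_LPP.simps(2) [simp del]

section \<open>Partitions and skew Schur functions\<close>

text \<open>Partitions are weakly decreasing, eventually vanishing sequences. Parts are numbered from
  \<open>0\<close>, so the first part, usually written \<open>\<lambda>\<^sub>1\<close>, is \<open>\<lambda> 0\<close>. Containment of Young diagrams is the
  pointwise order.\<close>

definition partitions :: "(nat \<Rightarrow> nat) set" where
  "partitions = {lam. antimono lam \<and> finite {r. lam r \<noteq> 0}}"

definition empty_partition :: "nat \<Rightarrow> nat" where
  "empty_partition = (\<lambda>_. 0)"

definition conjugate :: "(nat \<Rightarrow> nat) \<Rightarrow> nat \<Rightarrow> nat" where
  "conjugate lam s = card {r. s < lam r}"

definition even_partition :: "(nat \<Rightarrow> nat) \<Rightarrow> bool" where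
  "even_partition lam \<longleftrightarrow> (\<forall>r. even (lam r))"

definition skew_cells :: "(nat \<Rightarrow> nat) \<Rightarrow> (nat \<Rightarrow> nat) \<Rightarrow> (nat \<times> nat) set" where
  "skew_cells lam mu = {(r, s). mu r \<le> s \<and> s < lam r}"

text \<open>Semistandard tableaux of shape \<open>\<lambda>/\<mu>\<close> with entries in \<open>{0..<N}\<close>.\<close>

definition SSYT :: "(nat \<Rightarrow> nat) \<Rightarrow> (nat \<Rightarrow> nat) \<Rightarrow> nat \<Rightarrow> (nat \<times> nat \<Rightarrow> nat) set" where
  "SSYT lam mu N = {T \<in> skew_cells lam mu \<rightarrow>\<^sub>E {..<N}.
     (\<forall>r s s'. (r, s) \<in> skew_cells lam mu \<longrightarrow> (r, s') \<in> skew_cells lam mu \<longrightarrow> s < s'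
         \<longrightarrow> T (r, s) \<le> T (r, s')) \<and>
     (\<forall>r r' s. (r, s) \<in> skew_cells lam mu \<longrightarrow> (r', s) \<in> skew_cells lam mu \<longrightarrow> r < r'
         \<longrightarrow> T (r, s) < T (r', s))}"

text \<open>The skew Schur function \<open>s\<^bsub>\<lambda>/\<mu>\<^esub>\<close> evaluated at the finite list \<open>\<rho>\<close> of variables.\<close>

definition skew_schur :: "(nat \<Rightarrow> nat) \<Rightarrow> (nat \<Rightarrow> nat) \<Rightarrow> real list \<Rightarrow> real" where
  "skew_schur lam mu rho =
    (if mu \<le> lam then \<Sum>T\<in>SSYT lam mu (length rho). \<Prod>x\<in>skew_cells lam mu. rho ! T x else 0)"

text \<open>Only the finitely many \<open>\<kappa> \<subseteq> \<lambda>\<close> contribute to the sum.\<close>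

definition tau :: "(nat \<Rightarrow> nat) \<Rightarrow> real list \<Rightarrow> real" where
  "tau lam rho =
    (\<Sum>\<^sub>\<infinity>kappa\<in>{kappa \<in> partitions. even_partition (conjugate kappa)}. skew_schur lam kappa rho)"

section \<open>Pfaffian Schur processes\<close>

text \<open>The measure on the discrete space \<open>A\<close> giving each point mass proportional to its weight.
  If the total weight is \<open>0\<close> or \<open>\<infinity>\<close>, this is the null measure, so it is a probability measure
  if and only if the total weight is positive and finite.\<close>

definition proportional_measure :: "'a set \<Rightarrow> ('a \<Rightarrow> real) \<Rightarrow> 'a measure" where
  "proportional_measure A w =
    density (count_space A)
      (\<lambda>x. ennreal (w x) / (\<integral>\<^sup>+ y. ennreal (w y) \<partial>count_space A))"

text \<open>A configuration is a pair of families \<open>(lam 1, \<dots>, lam n)\<close> and \<open>(mu 1, \<dots>, mu (n - 1))\<close>.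
  The required inclusions are not imposed on the state space, as the weight vanishes when one of
  them fails.\<close>

definition PSP_weight ::
  "nat \<Rightarrow> (nat \<Rightarrow> real list) \<Rightarrow> (nat \<Rightarrow> real list)
    \<Rightarrow> (nat \<Rightarrow> nat \<Rightarrow> nat) \<times> (nat \<Rightarrow> nat \<Rightarrow> nat) \<Rightarrow> real" where
  "PSP_weight n rho_plus rho_minus = (\<lambda>(lam, mu).
     tau (lam 1) (rho_plus 0)
     * (\<Prod>k\<in>{1..<n}. skew_schur (lam k) (mu k) (rho_minus k)
                    * skew_schur (lam (Suc k)) (mu k) (rho_plus k))
     * skew_schur (lam n) empty_partition (rho_minus n))"

definition PSP ::
  "nat \<Rightarrow> (nat \<Rightarrow> real list) \<Rightarrow> (nat \<Rightarrow> real list)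
    \<Rightarrow> ((nat \<Rightarrow> nat \<Rightarrow> nat) \<times> (nat \<Rightarrow> nat \<Rightarrow> nat)) measure" where
  "PSP n rho_plus rho_minus =
     proportional_measure (({1..n} \<rightarrow>\<^sub>E partitions) \<times> ({1..<n} \<rightarrow>\<^sub>E partitions))
       (PSP_weight n rho_plus rho_minus)"

section \<open>Zig-zag paths\<close>

text \<open>An oriented edge \<open>(u, v)\<close> goes from \<open>u\<close> to \<open>v\<close>, one unit to the left or upwards.\<close>

definition horizontal_edge :: "(nat \<times> nat) \<times> (nat \<times> nat) \<Rightarrow> bool" where
  "horizontal_edge = (\<lambda>(u, v). fst u = Suc (fst v) \<and> snd u = snd v)"

definition vertical_edge :: "(nat \<times> nat) \<times> (nat \<times> nat) \<Rightarrow> bool" where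
  "vertical_edge = (\<lambda>(u, v). fst u = fst v \<and> snd v = Suc (snd u))"

text \<open>A path coming from \<open>(+\<infinity>, 0)\<close> has a last but no first vertex, so its vertices are enumerated
  backwards: \<open>p 0 = (N, N)\<close> is the point where the diagonal is hit, and the path runs from
  \<open>p (Suc t)\<close> to \<open>p t\<close>. The difference of the coordinates of \<open>p t\<close> is \<open>t\<close>, hence the diagonal
  is hit only there. Once \<open>snd (p t) = 0\<close>, all further edges lie on the horizontal axis. The final
  edge from \<open>(N, N)\<close> to the origin is determined by \<open>p 0\<close> and left implicit.\<close>

definition zigzag_paths :: "(nat \<Rightarrow> nat \<times> nat) set" where
  "zigzag_paths = {p.
     (\<exists>N>0. p 0 = (N, N)) \<and>
     (\<forall>t. horizontal_edge (p (Suc t), p t) \<or> vertical_edge (p (Suc t), p t)) \<and>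
     (\<exists>t. snd (p t) = 0)}"

definition path_edges :: "(nat \<Rightarrow> nat \<times> nat) \<Rightarrow> ((nat \<times> nat) \<times> (nat \<times> nat)) set" where
  "path_edges p = range (\<lambda>t. (p (Suc t), p t))"

definition edge_weight ::
  "((nat \<times> nat) \<times> (nat \<times> nat) \<Rightarrow> real list) \<Rightarrow> (nat \<times> nat \<Rightarrow> nat \<Rightarrow> nat)
    \<Rightarrow> (nat \<times> nat) \<times> (nat \<times> nat) \<Rightarrow> real" where
  "edge_weight rho Lam = (\<lambda>(u, v).
     if horizontal_edge (u, v) then skew_schur (Lam u) (Lam v) (rho (u, v))
     else skew_schur (Lam v) (Lam u) (rho (u, v)))"

text \<open>Edges on the horizontal axis, which are those ending at height \<open>0\<close>, carry weight \<open>1\<close>. Leaving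
  them out makes the product finite.\<close>

definition zigzag_weight ::
  "(nat \<Rightarrow> nat \<times> nat) \<Rightarrow> real list \<Rightarrow> ((nat \<times> nat) \<times> (nat \<times> nat) \<Rightarrow> real list)
    \<Rightarrow> (nat \<times> nat \<Rightarrow> nat \<Rightarrow> nat) \<Rightarrow> real" where
  "zigzag_weight p rho_diag rho Lam =
     tau (Lam (p 0)) rho_diag
     * (\<Prod>e\<in>{e \<in> path_edges p. snd (snd e) > 0}. edge_weight rho Lam e)"

definition zigzag_process ::
  "(nat \<Rightarrow> nat \<times> nat) \<Rightarrow> real list \<Rightarrow> ((nat \<times> nat) \<times> (nat \<times> nat) \<Rightarrow> real list)
    \<Rightarrow> (nat \<times> nat \<Rightarrow> nat \<Rightarrow> nat) measure" where
  "zigzag_process p rho_diag rho =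
     proportional_measure
       {Lam \<in> range p \<rightarrow>\<^sub>E partitions. \<forall>v\<in>range p. snd v = 0 \<longrightarrow> Lam v = empty_partition}
       (zigzag_weight p rho_diag rho)"

text \<open>The larger of the two coordinates that differ along the edge indexes its variable: that of
  the tail for horizontal edges and that of the head for vertical ones.\<close>

definition single_variable_label ::
  "(nat \<Rightarrow> real) \<Rightarrow> (nat \<times> nat) \<times> (nat \<times> nat) \<Rightarrow> real list" where
  "single_variable_label a = (\<lambda>(u, v).
     if horizontal_edge (u, v) then [a (fst u)] else [a (snd v)])"

section \<open>The specializations along a down-right sequence of points\<close>

definition LPP_rho_plus ::
  "real \<Rightarrow> (nat \<Rightarrow> real) \<Rightarrow> (nat \<Rightarrow> nat) \<Rightarrow> (nat \<Rightarrow> nat) \<Rightarrow> nat \<Rightarrow> real list" where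
  "LPP_rho_plus c a i j k =
     (if k = 0 then c # map a [Suc (j 1)..<Suc (i 1)]
      else map a [Suc (i k)..<Suc (i (Suc k))])"

definition LPP_rho_minus ::
  "(nat \<Rightarrow> real) \<Rightarrow> nat \<Rightarrow> (nat \<Rightarrow> nat) \<Rightarrow> nat \<Rightarrow> real list" where
  "LPP_rho_minus a n j k =
     (if k = n then map a [1..<Suc (j n)]
      else map a [Suc (j (Suc k))..<Suc (j k)])"

end

theory Submission
  imports Defs
begin

text \<open>The Robinson--Schensted--Knuth local growth rule, applied to the geometric weights, attaches to
  every point \<open>(x, y)\<close> with \<open>y \<le> x\<close> a partition whose first part satisfies the recursion of
  \<open>G(x, y)\<close>. Pushing a path through one more box replaces one partition along the path by another;
  this is a bijection which takes the path weight of the Pfaffian Schur process to itself times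
  \<open>q ^ k\<close>, where \<open>k\<close> is the weight in the box and \<open>q\<close> its parameter. Starting from the horizontal
  axis, the weights below a path are thus in bijection with the sequences of partitions along it
  that have nonzero path weight, and the probability of such a sequence is its path weight times
  the constant \<open>\<Prod>(1 - q)\<close>. Hence the growth diagram along the path is the zig-zag process.
  Summing out the partitions inside the straight pieces of the path with the branching rule for
  skew Schur functions gives the process \<open>PSP\<close> at the corners.\<close>

section \<open>Skew Schur functions\<close>

text \<open>The constant is tied to the processes by total mass: point masses that are a common
  multiple of the weights and sum to one force the total weight to be finite and equal to the
  inverse of that multiple. Normalisability is thus part of the conclusion. The box parameters arise
  because each edge label moves to the opposite side of the box and leaves a \<open>k\<close>-th
  power behind; on the diagonal the label \<open>c\<close> takes the place of the second edge label.
  The obstacle in summing out is that infinitely many partitions are candidates at a vertex inside a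
  straight piece. The path is therefore traversed away from the diagonal: on a horizontal piece the
  partition to be removed is contained in the following one, on a vertical piece in the one recorded
  at the outer corner, so only finitely many contribute.\<close>

lemma partitions_antimono: "lam \<in> partitions \<Longrightarrow> r \<le> r' \<Longrightarrow> lam r' \<le> lam r"
  by (auto simp: partitions_def antimono_def)

lemma partitions_finite_support: "lam \<in> partitions \<Longrightarrow> finite {r. lam r \<noteq> 0}"
  by (simp add: partitions_def)

lemma partitions_eventually_zero:
  assumes "lam \<in> partitions"
  obtains R where "\<And>r. r \<ge> R \<Longrightarrow> lam r = 0"
proof -
  obtain R where "\<forall>r\<in>{r. lam r \<noteq> 0}. r < R"
    using partitions_finite_support[OF assms] finite_nat_set_iff_bounded by blast
  then show ?thesis by (intro that[of R]) force
qed

lemma partitionsI: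
  assumes "\<And>r. lam (Suc r) \<le> lam r" and "\<And>r. r \<ge> R \<Longrightarrow> lam r = 0"
  shows "lam \<in> partitions"
proof -
  have "{r. lam r \<noteq> 0} \<subseteq> {..<R}"
    using assms(2) by (force simp: not_less[symmetric])
  then have "finite {r. lam r \<noteq> 0}"
    using finite_subset by blast
  moreover have "antimono lam"
    using assms(1) by (simp add: decseq_SucI)
  ultimately show ?thesis by (simp add: partitions_def)
qed

lemma partitions_below:
  assumes "lam \<in> partitions" "\<And>r. mu (Suc r) \<le> mu r" "mu \<le> lam"
  shows "mu \<in> partitions"
proof -
  obtain R where "\<And>r. r \<ge> R \<Longrightarrow> lam r = 0"
    using partitions_eventually_zero[OF assms(1)] by blast
  then show ?thesis
    using assms(2,3) by (intro partitionsI[of mu R]) (auto simp: le_fun_def, metis le_zero_eq)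
qed

lemma empty_partition_in_partitions [simp]: "empty_partition \<in> partitions"
  by (simp add: partitions_def empty_partition_def antimono_def)

lemma le_empty_partition_iff [simp]: "lam \<le> empty_partition \<longleftrightarrow> lam = empty_partition"
  by (auto simp: empty_partition_def le_fun_def)

lemma finite_partitions_below:
  assumes "lam \<in> partitions"
  shows "finite {nu \<in> partitions. nu \<le> lam}"
proof (rule finite_subset)
  show "{nu \<in> partitions. nu \<le> lam} \<subseteq>
      {f. \<forall>r. (r \<in> {r. lam r \<noteq> 0} \<longrightarrow> f r \<in> {..lam 0}) \<and> (r \<notin> {r. lam r \<noteq> 0} \<longrightarrow> f r = 0)}"
    using partitions_antimono[OF assms, of 0]
    by (auto simp: le_fun_def intro: order_trans) (metis le_zero_eq)
  show "finite \<dots>"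
    by (rule finite_set_of_finite_funs) (use partitions_finite_support[OF assms] in auto)
qed

lemma countable_partitions: "countable partitions"
proof (rule countable_subset)
  show "partitions \<subseteq> range (\<lambda>xs r. if r < length xs then xs ! r else 0)"
  proof
    fix lam assume "lam \<in> partitions"
    then obtain R where "\<And>r. r \<ge> R \<Longrightarrow> lam r = 0"
      using partitions_eventually_zero by blast
    then have "lam = (\<lambda>r. if r < length (map lam [0..<R]) then map lam [0..<R] ! r else 0)"
      by auto
    then show "lam \<in> range (\<lambda>xs r. if r < length xs then xs ! r else 0)"
      by blast
  qed
qed simp

lemma finite_skew_cells: "lam \<in> partitions \<Longrightarrow> finite (skew_cells lam mu)"
  by (rule finite_subset[of _ "Sigma {r. lam r \<noteq> 0} (\<lambda>r. {..<lam r})"])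
    (use partitions_finite_support in \<open>auto simp: skew_cells_def intro!: finite_SigmaI\<close>)

lemma finite_SSYT: "lam \<in> partitions \<Longrightarrow> finite (SSYT lam mu N)"
  unfolding SSYT_def
  by (rule finite_subset[of _ "skew_cells lam mu \<rightarrow>\<^sub>E {..<N}"])
    (auto intro!: finite_PiE simp: finite_skew_cells)

section \<open>Horizontal strips and skew Schur functions in at most one variable\<close>

text \<open>For partitions, this interlacing says that \<open>mu \<le> lam\<close> and that
  \<open>lam/mu\<close> has at most one cell in each column.\<close>

definition horizontal_strip :: "(nat \<Rightarrow> nat) \<Rightarrow> (nat \<Rightarrow> nat) \<Rightarrow> bool" where
  "horizontal_strip lam mu \<longleftrightarrow> (\<forall>r. mu r \<le> lam r \<and> lam (Suc r) \<le> mu r)"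

text \<open>Only the empty shape has a tableau without entries. The resulting point mass turns a
  partition recorded at a corner into the starting weight of the next straight piece.\<close>

lemma skew_schur_Nil:
  assumes "lam \<in> partitions"
  shows "skew_schur lam mu [] = (if lam = mu then 1 else 0)"
proof (cases "mu \<le> lam")
  case True
  show ?thesis
  proof (cases "lam = mu")
    case True
    then have "skew_cells lam mu = {}" by (auto simp: skew_cells_def)
    moreover from this have "SSYT lam mu 0 = {\<lambda>_. undefined}" by (auto simp: SSYT_def)
    ultimately show ?thesis using True by (simp add: skew_schur_def)
  next
    case False
    then obtain r where "lam r \<noteq> mu r" by blast
    then have "(r, mu r) \<in> skew_cells lam mu"
      using True by (auto simp: skew_cells_def le_fun_def le_neq_implies_less)
    then have "SSYT lam mu 0 = {}" by (fastforce simp: SSYT_def)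
    then show ?thesis using False by (simp add: skew_schur_def)
  qed
qed (auto simp: skew_schur_def)

text \<open>All entries are \<open>0\<close>, so a tableau exists exactly when no column has two
  cells; it is then unique, with one factor \<open>b\<close> per cell.\<close>

lemma skew_schur_single:
  assumes "lam \<in> partitions" "mu \<in> partitions"
  shows "skew_schur lam mu [b] =
    (if horizontal_strip lam mu then b ^ card (skew_cells lam mu) else 0)"
proof (cases "mu \<le> lam")
  case True
  show ?thesis
  proof (cases "horizontal_strip lam mu")
    case True
    have no_column: False
      if "(r, s) \<in> skew_cells lam mu" "(r', s) \<in> skew_cells lam mu" "r < r'" for r r' s
    proof -
      have "lam r' \<le> lam (Suc r)"
        using that partitions_antimono[OF assms(1)] by auto
      also have "\<dots> \<le> mu r"
        using True by (auto simp: horizontal_strip_def)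
      finally show False
        using that by (auto simp: skew_cells_def)
    qed
    have "SSYT lam mu 1 = {\<lambda>x\<in>skew_cells lam mu. 0}"
      using no_column
      by (auto simp: SSYT_def PiE_iff extensional_def restrict_def fun_eq_iff)
    then show ?thesis
      using True \<open>mu \<le> lam\<close> by (simp add: skew_schur_def)
  next
    case False
    then obtain r where r: "mu r < lam (Suc r)"
      using \<open>mu \<le> lam\<close> by (metis horizontal_strip_def le_fun_def not_le)
    have "(r, mu r) \<in> skew_cells lam mu" "(Suc r, mu r) \<in> skew_cells lam mu"
      using r partitions_antimono[OF assms(1), of r "Suc r"]
        partitions_antimono[OF assms(2), of r "Suc r"]
      by (auto simp: skew_cells_def)
    then have "SSYT lam mu 1 = {}"
      by (auto simp: SSYT_def PiE_iff) (metis less_irrefl lessI)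
    then show ?thesis
      using False by (simp add: skew_schur_def)
  qed
qed (auto simp: skew_schur_def horizontal_strip_def le_fun_def)

section \<open>Removing the largest entry: the branching rule\<close>

text \<open>Turns counts into thresholds: the rows of a core and the columns of a partition are
  measured by cardinalities, and this recovers \<open>s < card D\<close> as membership of
  \<open>s\<close> in \<open>D\<close>.\<close>

lemma initial_segment_nat:
  fixes D :: "nat set"
  assumes "finite D" and "\<And>s s'. s \<in> D \<Longrightarrow> s' < s \<Longrightarrow> s' \<in> D"
  shows "D = {..<card D}"
proof (cases "D = {}")
  case False
  have "D = {..Max D}"
  proof
    show "D \<subseteq> {..Max D}" using assms(1) by auto
    show "{..Max D} \<subseteq> D"
      using assms(2)[OF Max_in[OF assms(1) False]] Max_in[OF assms(1) False] le_neq_implies_less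
      by (metis atMost_iff subsetI)
  qed
  then have "card D = Suc (Max D)" by (metis card_atMost)
  then show ?thesis using \<open>D = {..Max D}\<close> by (metis lessThan_Suc_atMost)
qed simp

text \<open>Removing the cells with the largest entry \<open>N\<close> from a tableau leaves a tableau of shape
  \<open>tableau_core N lam mu T / mu\<close>.\<close>

definition tableau_core ::
  "nat \<Rightarrow> (nat \<Rightarrow> nat) \<Rightarrow> (nat \<Rightarrow> nat) \<Rightarrow> (nat \<times> nat \<Rightarrow> nat) \<Rightarrow> nat \<Rightarrow> nat" where
  "tableau_core N lam mu T r = card {s. s < lam r \<and> (s < mu r \<or> T (r, s) < N)}"

lemma SSYT_row:
  assumes "T \<in> SSYT lam mu N" "mu r \<le> s" "s < s'" "s' < lam r"
  shows "T (r, s) \<le> T (r, s')"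
  using assms by (auto simp: SSYT_def skew_cells_def)

lemma SSYT_column:
  assumes "T \<in> SSYT lam mu N" "mu r \<le> s" "s < lam r" "mu r' \<le> s" "s < lam r'" "r < r'"
  shows "T (r, s) < T (r', s)"
  using assms by (auto simp: SSYT_def skew_cells_def)

lemma SSYT_entry:
  assumes "T \<in> SSYT lam mu N" "mu r \<le> s" "s < lam r"
  shows "T (r, s) < N"
  using assms by (auto simp: SSYT_def skew_cells_def PiE_iff)

lemma less_tableau_core_iff:
  assumes T: "T \<in> SSYT lam mu (Suc N)"
  shows "s < tableau_core N lam mu T r \<longleftrightarrow> s < lam r \<and> (s < mu r \<or> T (r, s) < N)"
proof -
  define D where "D = {s. s < lam r \<and> (s < mu r \<or> T (r, s) < N)}"
  have "D = {..<card D}"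
  proof (rule initial_segment_nat)
    show "finite D" by (auto simp: D_def)
    show "s' \<in> D" if "s \<in> D" "s' < s" for s s'
      using that SSYT_row[OF T, of r s' s] by (cases "s' < mu r") (auto simp: D_def)
  qed
  then have "s < card D \<longleftrightarrow> s \<in> D" by blast
  then show ?thesis by (simp add: tableau_core_def D_def)
qed

text \<open>A cell directly below an entry \<open>N\<close> would need an entry larger than
  \<open>N\<close>. Hence row \<open>Suc r\<close> of \<open>lam\<close> ends before the entries
  \<open>N\<close> of row \<open>r\<close> begin, which is the strip condition.\<close>

lemma tableau_core_bounds:
  assumes lam: "lam \<in> partitions" and mu: "mu \<in> partitions" and "mu \<le> lam"
    and T: "T \<in> SSYT lam mu (Suc N)"
  shows "tableau_core N lam mu T \<in> partitions" "tableau_core N lam mu T \<le> lam"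
    "mu \<le> tableau_core N lam mu T" "horizontal_strip lam (tableau_core N lam mu T)"
proof -
  note iff = less_tableau_core_iff[OF T]
  have le1: "tableau_core N lam mu T r \<le> lam r" for r
    using iff[of "lam r" r] by simp
  have le2: "mu r \<le> tableau_core N lam mu T r" for r
    using iff[of "tableau_core N lam mu T r" r] \<open>mu \<le> lam\<close>
    by (auto simp: le_fun_def) (meson leI order_less_le_trans)
  have le3: "lam (Suc r) \<le> tableau_core N lam mu T r" for r
  proof (rule ccontr)
    let ?s = "tableau_core N lam mu T r"
    assume "\<not> ?thesis"
    then have s: "?s < lam (Suc r)" by simp
    then have "?s < lam r"
      using partitions_antimono[OF lam, of r "Suc r"] by simp
    moreover have "mu (Suc r) \<le> ?s"
      using le2[of r] partitions_antimono[OF mu, of r "Suc r"] by simp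
    ultimately have "T (r, ?s) < T (Suc r, ?s)"
      using s le2[of r] by (intro SSYT_column[OF T]) auto
    moreover have "T (Suc r, ?s) < Suc N"
      using s \<open>mu (Suc r) \<le> ?s\<close> by (intro SSYT_entry[OF T]) auto
    ultimately show False
      using iff[of ?s r] \<open>?s < lam r\<close> by simp
  qed
  show "tableau_core N lam mu T \<le> lam" "mu \<le> tableau_core N lam mu T"
    using le1 le2 by (auto simp: le_fun_def)
  then show "tableau_core N lam mu T \<in> partitions"
    using le1 le3 by (intro partitions_below[OF lam]) (auto intro: order_trans)
  show "horizontal_strip lam (tableau_core N lam mu T)"
    using le1 le3 by (simp add: horizontal_strip_def)
qed

lemma SSYT_restrict_core:
  assumes "mu \<le> lam" and T: "T \<in> SSYT lam mu (Suc N)" and "nu = tableau_core N lam mu T"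
  shows "restrict T (skew_cells nu mu) \<in> SSYT nu mu N"
proof -
  have iff: "s < nu r \<longleftrightarrow> s < lam r \<and> (s < mu r \<or> T (r, s) < N)" for r s
    using less_tableau_core_iff[OF T] assms(3) by simp
  show ?thesis
    unfolding SSYT_def PiE_iff
    using SSYT_row[OF T] SSYT_column[OF T]
    by (auto simp: skew_cells_def iff)
qed

text \<open>If a column contains two cells of \<open>lam/mu\<close>, the strip condition forces the
  upper one into \<open>nu\<close>, where the entry is below \<open>N\<close>; filling
  \<open>lam/nu\<close> with \<open>N\<close> therefore keeps columns strict. The value
  \<open>undefined\<close> keeps the filling extensional.\<close>

lemma SSYT_extend_core:
  fixes T :: "nat \<times> nat \<Rightarrow> nat"
  assumes nu: "nu \<in> partitions" and lam: "lam \<in> partitions" and "mu \<le> nu"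
    and strip: "horizontal_strip lam nu" and T: "T \<in> SSYT nu mu N"
  defines "U \<equiv> \<lambda>x. if x \<in> skew_cells nu mu then T x
    else if x \<in> skew_cells lam nu then N else undefined"
  shows "U \<in> SSYT lam mu (Suc N)" "tableau_core N lam mu U = nu"
proof -
  have le: "mu r \<le> nu r" "nu r \<le> lam r" "lam (Suc r) \<le> nu r" for r
    using \<open>mu \<le> nu\<close> strip by (auto simp: le_fun_def horizontal_strip_def)
  have U1: "U (r, s) = T (r, s)" "T (r, s) < N" if "mu r \<le> s" "s < nu r" for r s
    using that SSYT_entry[OF T] by (auto simp: U_def skew_cells_def)
  have U2: "U (r, s) = N" if "nu r \<le> s" "s < lam r" for r s
    using that by (auto simp: U_def skew_cells_def)
  have U3: "U (r, s) = undefined" if "\<not> (mu r \<le> s \<and> s < lam r)" for r s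
    using that le(1,2)[of r] by (auto simp: U_def skew_cells_def)
  have U4: "U (r, s) \<le> N" if "mu r \<le> s" "s < lam r" for r s
    using that U1[of r s] U2[of r s] by (cases "s < nu r") auto
  have row: "U (r, s) \<le> U (r, s')" if "mu r \<le> s" "s < s'" "s' < lam r" for r s s'
  proof (cases "s' < nu r")
    case True
    then show ?thesis using that U1[of r s] U1[of r s'] SSYT_row[OF T, of r s s'] by simp
  next
    case False
    then show ?thesis using that U2[of r s'] U4[of r s] by simp
  qed
  have column: "U (r, s) < U (r', s)"
    if "mu r \<le> s" "mu r' \<le> s" "s < lam r'" "r < r'" for r r' s
  proof -
    have "s < lam (Suc r)"
      using that partitions_antimono[OF lam, of "Suc r" r'] by auto
    then have s: "s < nu r"
      using le(3)[of r] by simp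
    show ?thesis
    proof (cases "s < nu r'")
      case True
      then show ?thesis
        using that s U1[of r s] U1[of r' s] SSYT_column[OF T, of r s r'] by simp
    next
      case False
      then show ?thesis using that s U1[of r s] U2[of r' s] by simp
    qed
  qed
  show "U \<in> SSYT lam mu (Suc N)"
    unfolding SSYT_def PiE_iff extensional_def
    using row column U3 U4 by (auto simp: skew_cells_def less_Suc_eq_le)
  have "{s. s < lam r \<and> (s < mu r \<or> U (r, s) < N)} = {..<nu r}" for r
    using le[of r] U1[of r] U2[of r] by (auto simp: not_less[symmetric])
      (metis le_less_linear less_irrefl linorder_not_less)+
  then show "tableau_core N lam mu U = nu"
    by (auto simp: tableau_core_def)
qed

lemma SSYT_core_weight:
  assumes lam: "lam \<in> partitions" and "mu \<le> nu" "nu \<le> lam"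
    and T: "T \<in> SSYT lam mu (Suc (length rho))"
    and core: "tableau_core (length rho) lam mu T = nu"
  shows "(\<Prod>x\<in>skew_cells lam mu. (rho @ [b]) ! T x) =
    (\<Prod>x\<in>skew_cells nu mu. rho ! restrict T (skew_cells nu mu) x) * b ^ card (skew_cells lam nu)"
proof -
  have split: "skew_cells lam mu = skew_cells nu mu \<union> skew_cells lam nu"
    "skew_cells nu mu \<inter> skew_cells lam nu = {}"
    using assms(2,3) by (auto simp: skew_cells_def le_fun_def intro: order_trans less_le_trans)
  then have fin: "finite (skew_cells nu mu)" "finite (skew_cells lam nu)"
    using finite_skew_cells[OF lam, of mu] by auto
  have iff: "s < nu r \<longleftrightarrow> s < lam r \<and> (s < mu r \<or> T (r, s) < length rho)" for r s
    using less_tableau_core_iff[OF T] core by blast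
  have 1: "(rho @ [b]) ! T x = rho ! restrict T (skew_cells nu mu) x" if "x \<in> skew_cells nu mu" for x
    using that iff by (auto simp: skew_cells_def nth_append)
  have 2: "(rho @ [b]) ! T x = b" if "x \<in> skew_cells lam nu" for x
  proof -
    obtain r s where "x = (r, s)" by (cases x)
    then have x: "x = (r, s)" "nu r \<le> s" "s < lam r"
      using that by (auto simp: skew_cells_def)
    moreover have "mu r \<le> s"
      using \<open>mu \<le> nu\<close> x by (auto simp: le_fun_def intro: order_trans)
    ultimately have "T x = length rho"
      using iff[of s r] SSYT_entry[OF T, of r s] by simp
    then show ?thesis by simp
  qed
  show ?thesis
    by (simp add: split(1) prod.union_disjoint[OF fin split(2)] 1 2)
qed

text \<open>Tableaux are grouped by their core \<open>nu\<close>. Restricting to the core and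
  refilling with the largest entry identify each nonempty group with the tableaux of shape
  \<open>nu/mu\<close>, and each cell of \<open>lam/nu\<close> contributes \<open>b\<close>.\<close>

lemma skew_schur_snoc:
  assumes lam: "lam \<in> partitions" and mu: "mu \<in> partitions"
  shows "skew_schur lam mu (rho @ [b]) =
    (\<Sum>nu | nu \<in> partitions \<and> nu \<le> lam. skew_schur nu mu rho * skew_schur lam nu [b])"
proof (cases "mu \<le> lam")
  case False
  then have "skew_schur nu mu rho = 0" if "nu \<le> lam" for nu
    using that order_trans by (auto simp: skew_schur_def)
  then show ?thesis
    using False by (simp add: skew_schur_def)
next
  case True
  define N where "N = length rho"
  define S where "S = SSYT lam mu (Suc N)"
  let ?P = "{nu \<in> partitions. nu \<le> lam}"
  let ?core = "tableau_core N lam mu"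
  let ?w = "\<lambda>T. \<Prod>x\<in>skew_cells lam mu. (rho @ [b]) ! T x"
  have fiber: "(\<Sum>T | T \<in> S \<and> ?core T = nu. ?w T) = skew_schur nu mu rho * skew_schur lam nu [b]"
    if nu: "nu \<in> partitions" "nu \<le> lam" for nu
  proof (cases "mu \<le> nu \<and> horizontal_strip lam nu")
    case False
    then have "{T. T \<in> S \<and> ?core T = nu} = {}"
      using tableau_core_bounds(3,4)[OF lam mu True, of _ N] by (auto simp: S_def)
    then have "(\<Sum>T | T \<in> S \<and> ?core T = nu. ?w T) = 0"
      by (simp only: sum.empty)
    then show ?thesis
      using False nu lam by (auto simp: skew_schur_def[of nu] skew_schur_single)
  next
    case True
    let ?extend = "\<lambda>T x. if x \<in> skew_cells nu mu then T x
      else if x \<in> skew_cells lam nu then N else undefined"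
    have "(\<Sum>T | T \<in> S \<and> ?core T = nu. ?w T) =
        (\<Sum>T\<in>SSYT nu mu N. (\<Prod>x\<in>skew_cells nu mu. rho ! T x) * b ^ card (skew_cells lam nu))"
    proof (rule sum.reindex_bij_witness[where i = ?extend
          and j = "\<lambda>T. restrict T (skew_cells nu mu)"])
      fix T assume T: "T \<in> {T. T \<in> S \<and> ?core T = nu}"
      then have T': "T \<in> SSYT lam mu (Suc N)" "nu = ?core T" by (auto simp: S_def)
      show "restrict T (skew_cells nu mu) \<in> SSYT nu mu N"
        using SSYT_restrict_core[OF \<open>mu \<le> lam\<close> T'] .
      show "?extend (restrict T (skew_cells nu mu)) = T"
      proof
        fix x :: "nat \<times> nat"
        obtain r s where x: "x = (r, s)" by (cases x)
        show "?extend (restrict T (skew_cells nu mu)) x = T x"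
        proof (cases "mu r \<le> s \<and> s < lam r")
          case True
          then show ?thesis
            using less_tableau_core_iff[OF T'(1), of s r] SSYT_entry[OF T'(1), of r s] T'(2)
            by (auto simp: x skew_cells_def)
        next
          case False
          then have "x \<notin> skew_cells lam mu" by (auto simp: x skew_cells_def)
          moreover from this have "x \<notin> skew_cells nu mu" "x \<notin> skew_cells lam nu"
            using \<open>nu \<le> lam\<close> True
            by (auto simp: x skew_cells_def le_fun_def intro: order_trans less_le_trans)
          moreover have "T x = undefined"
            using T'(1) \<open>x \<notin> skew_cells lam mu\<close> unfolding SSYT_def by (blast intro: PiE_arb)
          ultimately show ?thesis by simp
        qed
      qed
      show "(\<Prod>x\<in>skew_cells nu mu. rho ! restrict T (skew_cells nu mu) x)
          * b ^ card (skew_cells lam nu) = ?w T"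
        using SSYT_core_weight[OF lam, of mu nu T rho b] True nu(2) T'(1) T'(2)[symmetric]
        by (simp add: N_def)
    next
      fix T assume T: "T \<in> SSYT nu mu N"
      then have "T x = undefined" if "x \<notin> skew_cells nu mu" for x
        using that unfolding SSYT_def by (blast intro: PiE_arb)
      then show "restrict (?extend T) (skew_cells nu mu) = T"
        by (auto simp: fun_eq_iff)
      show "?extend T \<in> {T. T \<in> S \<and> ?core T = nu}"
        using SSYT_extend_core[OF nu(1) lam _ _ T] True by (auto simp: S_def)
    qed
    then show ?thesis
      using True nu lam by (simp add: skew_schur_def[of nu] skew_schur_single N_def sum_distrib_right)
  qed
  have "(\<Sum>T\<in>S. ?w T) = (\<Sum>nu\<in>?P. \<Sum>T | T \<in> S \<and> ?core T = nu. ?w T)"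
    using tableau_core_bounds(1,2)[OF lam mu True, of _ N] finite_SSYT[OF lam]
    by (intro sum.group[symmetric]) (auto simp: S_def finite_partitions_below[OF lam])
  also have "\<dots> = (\<Sum>nu\<in>?P. skew_schur nu mu rho * skew_schur lam nu [b])"
    by (intro sum.cong) (use fiber in auto)
  finally show ?thesis
    using True by (simp add: skew_schur_def[of lam mu] S_def N_def)
qed

lemma skew_schur_eq_0: "\<not> mu \<le> lam \<Longrightarrow> skew_schur lam mu rho = 0"
  by (simp add: skew_schur_def)

text \<open>Gives inner sums a range independent of the outer summation index, so that double sums
  can be interchanged.\<close>

lemma sum_partitions_below_extend:
  assumes "lam \<in> partitions" "eta \<le> lam" and "\<And>nu. \<not> nu \<le> eta \<Longrightarrow> f nu = (0 :: real)"
  shows "(\<Sum>nu | nu \<in> partitions \<and> nu \<le> eta. f nu) = (\<Sum>nu | nu \<in> partitions \<and> nu \<le> lam. f nu)"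
  using assms order_trans
  by (intro sum.mono_neutral_left) (auto simp: finite_partitions_below)

lemma skew_schur_append:
  assumes "lam \<in> partitions" and mu: "mu \<in> partitions"
  shows "skew_schur lam mu (rho @ xi) =
    (\<Sum>nu | nu \<in> partitions \<and> nu \<le> lam. skew_schur nu mu rho * skew_schur lam nu xi)"
  using assms(1)
proof (induction xi arbitrary: lam rule: rev_induct)
  case Nil
  then have "(\<Sum>nu | nu \<in> partitions \<and> nu \<le> lam. skew_schur nu mu rho * skew_schur lam nu [])
      = (\<Sum>nu | nu \<in> partitions \<and> nu \<le> lam. if nu = lam then skew_schur nu mu rho else 0)"
    by (intro sum.cong) (auto simp: skew_schur_Nil)
  also have "\<dots> = skew_schur lam mu rho"
    using Nil by (simp add: sum.delta' finite_partitions_below)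
  finally show ?case by simp
next
  case (snoc b xi)
  let ?P = "{nu \<in> partitions. nu \<le> lam}"
  have "skew_schur lam mu (rho @ xi @ [b]) =
      (\<Sum>eta\<in>?P. skew_schur eta mu (rho @ xi) * skew_schur lam eta [b])"
    using skew_schur_snoc[OF snoc.prems mu, of "rho @ xi"] by simp
  also have "\<dots> = (\<Sum>eta\<in>?P. (\<Sum>nu\<in>?P. skew_schur nu mu rho * skew_schur eta nu xi)
      * skew_schur lam eta [b])"
  proof (intro sum.cong refl)
    fix eta assume "eta \<in> ?P"
    then show "skew_schur eta mu (rho @ xi) * skew_schur lam eta [b] =
        (\<Sum>nu\<in>?P. skew_schur nu mu rho * skew_schur eta nu xi) * skew_schur lam eta [b]"
      using snoc.IH[of eta] sum_partitions_below_extend[OF snoc.prems, of eta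
          "\<lambda>nu. skew_schur nu mu rho * skew_schur eta nu xi"]
      by (auto simp: skew_schur_eq_0)
  qed
  also have "\<dots> = (\<Sum>nu\<in>?P. skew_schur nu mu rho *
      (\<Sum>eta\<in>?P. skew_schur eta nu xi * skew_schur lam eta [b]))"
    unfolding sum_distrib_left sum_distrib_right mult.assoc by (rule sum.swap)
  also have "\<dots> = (\<Sum>nu\<in>?P. skew_schur nu mu rho * skew_schur lam nu (xi @ [b]))"
    using skew_schur_snoc[OF snoc.prems] by (intro sum.cong) auto
  finally show ?case .
qed

section \<open>The function \<open>tau\<close>: finite form, branching, one variable\<close>

lemma tau_eq_sum:
  assumes "lam \<in> partitions"
  shows "tau lam rho = (\<Sum>kappa | kappa \<in> partitions \<and> kappa \<le> lam.
    if even_partition (conjugate kappa) then skew_schur lam kappa rho else 0)"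
proof -
  have "tau lam rho = (\<Sum>\<^sub>\<infinity>kappa\<in>{kappa \<in> partitions. kappa \<le> lam}.
      if even_partition (conjugate kappa) then skew_schur lam kappa rho else 0)"
    unfolding tau_def by (rule infsum_cong_neutral) (auto simp: skew_schur_eq_0)
  then show ?thesis
    by (simp add: finite_partitions_below assms)
qed

text \<open>Branching at the last variable affects the outer partition only, so it passes through
  the sum over \<open>kappa\<close>.\<close>

lemma tau_snoc:
  assumes lam: "lam \<in> partitions"
  shows "tau lam (rho @ [b]) =
    (\<Sum>nu | nu \<in> partitions \<and> nu \<le> lam. tau nu rho * skew_schur lam nu [b])"
proof -
  let ?P = "{nu \<in> partitions. nu \<le> lam}"
  let ?e = "\<lambda>kappa x. if even_partition (conjugate kappa) then x else (0 :: real)"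
  have "tau lam (rho @ [b]) =
      (\<Sum>kappa\<in>?P. \<Sum>nu\<in>?P. ?e kappa (skew_schur nu kappa rho) * skew_schur lam nu [b])"
    unfolding tau_eq_sum[OF lam] using skew_schur_snoc[OF lam]
    by (intro sum.cong) auto
  also have "\<dots> = (\<Sum>nu\<in>?P. (\<Sum>kappa\<in>?P. ?e kappa (skew_schur nu kappa rho)) * skew_schur lam nu [b])"
    unfolding sum_distrib_right by (rule sum.swap)
  also have "\<dots> = (\<Sum>nu\<in>?P. tau nu rho * skew_schur lam nu [b])"
  proof (intro sum.cong refl)
    fix nu assume "nu \<in> ?P"
    then show "(\<Sum>kappa\<in>?P. ?e kappa (skew_schur nu kappa rho)) * skew_schur lam nu [b] =
        tau nu rho * skew_schur lam nu [b]"
      using sum_partitions_below_extend[OF lam, of nu "\<lambda>kappa. ?e kappa (skew_schur nu kappa rho)"]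
        tau_eq_sum[of nu rho]
      by (auto simp: skew_schur_eq_0)
  qed
  finally show ?thesis .
qed

lemma card_skew_cells:
  assumes "\<And>r. r \<ge> R \<Longrightarrow> lam r = 0"
  shows "card (skew_cells lam mu) = (\<Sum>r<R. lam r - mu r)"
proof -
  have "skew_cells lam mu = Sigma {..<R} (\<lambda>r. {mu r..<lam r})"
    using assms by (force simp: skew_cells_def not_le[symmetric])
  then show ?thesis by simp
qed

text \<open>The parts of the conjugate are the column lengths. A column of length
  \<open>Suc (2 * i)\<close> exists exactly when row \<open>2 * i\<close> is longer than row
  \<open>Suc (2 * i)\<close>, and the column with index \<open>kappa (Suc (2 * i))\<close> is then
  one.\<close>

lemma even_conjugate_iff:
  assumes "kappa \<in> partitions"
  shows "even_partition (conjugate kappa) \<longleftrightarrow> (\<forall>i. kappa (2 * i) = kappa (Suc (2 * i)))"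
proof
  assume even: "even_partition (conjugate kappa)"
  show "\<forall>i. kappa (2 * i) = kappa (Suc (2 * i))"
  proof (rule allI, rule ccontr)
    fix i assume "kappa (2 * i) \<noteq> kappa (Suc (2 * i))"
    then have less: "kappa (Suc (2 * i)) < kappa (2 * i)"
      using partitions_antimono[OF assms, of "2 * i" "Suc (2 * i)"] by simp
    have "{r. kappa (Suc (2 * i)) < kappa r} = {..<Suc (2 * i)}"
    proof (intro set_eqI iffI)
      fix r assume "r \<in> {r. kappa (Suc (2 * i)) < kappa r}"
      then show "r \<in> {..<Suc (2 * i)}"
        using partitions_antimono[OF assms, of "Suc (2 * i)" r] by (auto simp: not_less[symmetric])
    next
      fix r assume "r \<in> {..<Suc (2 * i)}"
      then show "r \<in> {r. kappa (Suc (2 * i)) < kappa r}"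
        using less partitions_antimono[OF assms, of r "2 * i"] by auto
    qed
    then have "conjugate kappa (kappa (Suc (2 * i))) = Suc (2 * i)"
      by (simp add: conjugate_def)
    then show False
      using even by (metis even_partition_def even_Suc dvd_triv_left)
  qed
next
  assume pairs: "\<forall>i. kappa (2 * i) = kappa (Suc (2 * i))"
  show "even_partition (conjugate kappa)"
    unfolding even_partition_def
  proof (rule allI, rule ccontr)
    fix s assume "odd (conjugate kappa s)"
    then obtain i where i: "conjugate kappa s = Suc (2 * i)"
      by (metis oddE Suc_eq_plus1)
    have "{r. s < kappa r} = {..<card {r. s < kappa r}}"
    proof (rule initial_segment_nat)
      show "finite {r. s < kappa r}"
        by (rule finite_subset[OF _ partitions_finite_support[OF assms]]) auto
      show "r' \<in> {r. s < kappa r}" if "r \<in> {r. s < kappa r}" "r' < r" for r r'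
        using that partitions_antimono[OF assms, of r' r] by auto
    qed
    then have "{r. s < kappa r} = {..<Suc (2 * i)}"
      using i by (simp add: conjugate_def)
    then have "s < kappa (2 * i)" "\<not> s < kappa (Suc (2 * i))"
      by (auto simp: set_eq_iff)
    then show False using pairs by simp
  qed
qed

text \<open>A single variable leaves exactly one \<open>\<kappa>\<close> with \<open>\<kappa>'\<close> even: it is obtained from \<open>\<lambda>\<close> by shortening
  each row of odd number (counted from one) to the length of the next row.\<close>

lemma tau_single:
  assumes lam: "lam \<in> partitions" and zero: "\<And>r. r \<ge> 2 * R \<Longrightarrow> lam r = 0"
  shows "tau lam [c] = c ^ (\<Sum>i<R. lam (2 * i) - lam (Suc (2 * i)))"
proof -
  define kappa where "kappa r = lam (Suc (2 * (r div 2)))" for r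
  have anti: "r \<le> r' \<Longrightarrow> lam r' \<le> lam r" for r r'
    using partitions_antimono[OF lam] .
  have kappa_le: "kappa \<le> lam"
    unfolding le_fun_def kappa_def by (intro allI anti) presburger
  have strip: "horizontal_strip lam kappa"
    unfolding horizontal_strip_def
    using kappa_le by (auto simp: le_fun_def kappa_def intro!: anti)
  have kappa: "kappa \<in> partitions"
    using kappa_le by (intro partitions_below[OF lam]) (auto simp: kappa_def intro!: anti div_le_mono)
  have even: "even_partition (conjugate kappa)"
    unfolding even_conjugate_iff[OF kappa] by (simp add: kappa_def)
  \<comment> \<open>Interlacing and the equality of paired rows squeeze \<open>mu\<close>:
    \<open>lam (Suc (2 * i)) \<le> mu (2 * i) = mu (Suc (2 * i)) \<le> lam (Suc (2 *
    i))\<close>.\<close>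
  have unique: "mu = kappa"
    if mu: "mu \<in> partitions" "even_partition (conjugate mu)" "horizontal_strip lam mu" for mu
  proof
    fix r
    have mu_le: "lam (Suc r) \<le> mu r" "mu r \<le> lam r" for r
      using mu(3) by (auto simp: horizontal_strip_def)
    have pairs: "mu (2 * i) = mu (Suc (2 * i))" for i
      using mu(1,2) even_conjugate_iff by blast
    have "mu (2 * i) = lam (Suc (2 * i))" for i
      using mu_le(1)[of "2 * i"] mu_le(2)[of "Suc (2 * i)"] pairs[of i] by simp
    then show "mu r = kappa r"
      unfolding kappa_def using pairs[of "r div 2"]
      by (cases "even r") (auto elim!: evenE oddE)
  qed
  have "tau lam [c] = (\<Sum>mu | mu \<in> partitions \<and> mu \<le> lam.
      if mu = kappa then skew_schur lam kappa [c] else 0)"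
    unfolding tau_eq_sum[OF lam]
    using unique even by (intro sum.cong) (auto simp: skew_schur_single lam)
  also have "\<dots> = c ^ card (skew_cells lam kappa)"
    using kappa kappa_le strip
    by (simp add: sum.delta finite_partitions_below lam skew_schur_single)
  also have "card (skew_cells lam kappa) = (\<Sum>r<2 * R. lam r - kappa r)"
    by (rule card_skew_cells) (use zero in auto)
  \<comment> \<open>Rows with odd index agree in \<open>lam\<close> and \<open>kappa\<close>, so
    each pair of rows leaves one difference; the exponent is the number of columns of odd
    length.\<close>
  also have "\<dots> = (\<Sum>i<R. lam (2 * i) - lam (Suc (2 * i)))"
    by (induction R) (auto simp: kappa_def)
  finally show ?thesis .
qed

section \<open>The local growth rule\<close>

text \<open>The Robinson--Schensted--Knuth local rule in the form of a piecewise linear map.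
  For fixed \<open>mu\<close> and \<open>nu\<close> it is a bijection between the pairs \<open>(kap, k)\<close> with \<open>mu/kap\<close> and
  \<open>nu/kap\<close> horizontal strips and the partitions \<open>lam\<close> with \<open>lam/mu\<close> and \<open>lam/nu\<close>
  horizontal strips, realizing the skew Cauchy identity in two single variables; with \<open>mu = nu\<close>
  it also realizes the Littlewood-type identity needed at the diagonal.\<close>

definition rsk ::
  "(nat \<Rightarrow> nat) \<Rightarrow> (nat \<Rightarrow> nat) \<Rightarrow> (nat \<Rightarrow> nat) \<Rightarrow> nat \<Rightarrow> nat \<Rightarrow> nat" where
  "rsk mu nu kap k r = max (mu r) (nu r) +
     (case r of 0 \<Rightarrow> k | Suc i \<Rightarrow> min (mu i) (nu i) - kap i)"

lemma rsk_0: "rsk mu nu kap k 0 = max (mu 0) (nu 0) + k"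
  by (simp add: rsk_def)

lemma rsk_Suc: "rsk mu nu kap k (Suc r) = max (mu (Suc r)) (nu (Suc r)) + (min (mu r) (nu r) - kap r)"
  by (simp add: rsk_def)

lemma rsk_commute: "rsk mu nu = rsk nu mu"
  by (auto simp: rsk_def fun_eq_iff max.commute min.commute split: nat.split)

text \<open>The entry \<open>kap r\<close> separates \<open>max (mu (Suc r)) (nu (Suc r))\<close>
  from \<open>min (mu r) (nu r)\<close>, so adding the gap \<open>min (mu r) (nu r) - kap r\<close>
  to the former does not exceed the latter.\<close>

lemma rsk_strip:
  assumes "horizontal_strip mu kap" "horizontal_strip nu kap"
  shows "horizontal_strip (rsk mu nu kap k) mu" "horizontal_strip (rsk mu nu kap k) nu"
proof -
  have "kap r \<le> mu r \<and> mu (Suc r) \<le> kap r \<and> kap r \<le> nu r \<and> nu (Suc r) \<le> kap r" for r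
    using assms by (auto simp: horizontal_strip_def)
  moreover from this have "rsk mu nu kap k (Suc r) \<le> min (mu r) (nu r)" for r
    unfolding rsk_Suc by (metis add.commute add_diff_inverse_nat add_le_mono1 le_add_diff_inverse2
        max.bounded_iff min.bounded_iff not_less)
  moreover have "max (mu r) (nu r) \<le> rsk mu nu kap k r" for r
    by (simp add: rsk_def)
  ultimately show "horizontal_strip (rsk mu nu kap k) mu" "horizontal_strip (rsk mu nu kap k) nu"
    by (auto simp: horizontal_strip_def)
qed

lemma rsk_partition:
  assumes "mu \<in> partitions" "nu \<in> partitions" "horizontal_strip mu kap" "horizontal_strip nu kap"
  shows "rsk mu nu kap k \<in> partitions"
proof -
  obtain R where "\<And>r. r \<ge> R \<Longrightarrow> mu r = 0"
    using partitions_eventually_zero[OF assms(1)] by blast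
  moreover obtain R' where "\<And>r. r \<ge> R' \<Longrightarrow> nu r = 0"
    using partitions_eventually_zero[OF assms(2)] by blast
  ultimately have "rsk mu nu kap k r = 0" if "r \<ge> Suc (max R R')" for r
    using that by (auto simp: rsk_def split: nat.split)
  moreover have "rsk mu nu kap k (Suc r) \<le> rsk mu nu kap k r" for r
    using rsk_strip[OF assms(3,4)] order_trans unfolding horizontal_strip_def by blast
  ultimately show ?thesis
    by (rule partitionsI[rotated])
qed

text \<open>Row \<open>Suc r\<close> reveals \<open>min (mu r) (nu r) - kap r\<close> and row
  \<open>0\<close> reveals \<open>k\<close>. The strips bound \<open>kap r\<close> by the minimum,
  so truncated subtraction loses nothing.\<close>

lemma rsk_inj:
  assumes "horizontal_strip mu kap" "horizontal_strip nu kap"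
    and "horizontal_strip mu kap'" "horizontal_strip nu kap'"
    and eq: "rsk mu nu kap k = rsk mu nu kap' k'"
  shows "kap = kap'" "k = k'"
proof -
  show "kap = kap'"
  proof
    fix r
    have "kap r \<le> min (mu r) (nu r)" "kap' r \<le> min (mu r) (nu r)"
      using assms(1-4) by (auto simp: horizontal_strip_def)
    then show "kap r = kap' r"
      using fun_cong[OF eq, of "Suc r"] by (simp only: rsk_Suc)
  qed
  show "k = k'"
    using fun_cong[OF eq, of 0] by (simp add: rsk_0)
qed

lemma rsk_surj:
  assumes "mu \<in> partitions" "horizontal_strip lam mu" "horizontal_strip lam nu"
  obtains kap k where "kap \<in> partitions" "horizontal_strip mu kap" "horizontal_strip nu kap"
    "rsk mu nu kap k = lam"
proof -
  \<comment> \<open>The rule reflects \<open>kap r\<close> in the interval from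
    \<open>max (mu (Suc r)) (nu (Suc r))\<close> to \<open>min (mu r) (nu r)\<close> and calls the
    result \<open>lam (Suc r)\<close>; a reflection is its own inverse.\<close>
  define kap where "kap r = max (mu (Suc r)) (nu (Suc r)) + min (mu r) (nu r) - lam (Suc r)" for r
  have le: "mu r \<le> lam r" "lam (Suc r) \<le> mu r" "nu r \<le> lam r" "lam (Suc r) \<le> nu r" for r
    using assms(2,3) by (auto simp: horizontal_strip_def)
  have kap: "kap r \<le> mu r" "kap r \<le> nu r" "mu (Suc r) \<le> kap r" "nu (Suc r) \<le> kap r" for r
    using le[of r] le[of "Suc r"] by (auto simp: kap_def)
  show ?thesis
  proof
    show "horizontal_strip mu kap" "horizontal_strip nu kap"
      using kap by (auto simp: horizontal_strip_def)
    show "kap \<in> partitions"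
      using kap by (intro partitions_below[OF assms(1)]) (auto simp: le_fun_def intro: order_trans)
    show "rsk mu nu kap (lam 0 - max (mu 0) (nu 0)) = lam"
    proof
      fix r
      show "rsk mu nu kap (lam 0 - max (mu 0) (nu 0)) r = lam r"
      proof (cases r)
        case 0
        then show ?thesis using le[of 0] by (auto simp: rsk_def)
      next
        case (Suc i)
        then show ?thesis using le[of i] le[of "Suc i"] by (auto simp: rsk_def kap_def)
      qed
    qed
  qed
qed

text \<open>Maximum and minimum of \<open>mu r\<close> and \<open>nu r\<close> add up to
  \<open>mu r + nu r\<close>, so the new partition has the size of \<open>mu\<close> plus that of
  \<open>nu\<close> minus that of \<open>kap\<close>, plus \<open>k\<close>.\<close>

lemma card_rsk_cells:
  assumes "mu \<in> partitions" "nu \<in> partitions" "horizontal_strip mu kap" "horizontal_strip nu kap"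
  shows "card (skew_cells (rsk mu nu kap k) mu) = k + card (skew_cells nu kap)"
proof -
  let ?lam = "rsk mu nu kap k"
  have le: "mu r \<le> ?lam r" "kap r \<le> nu r" "kap r \<le> mu r" for r
    using rsk_strip[OF assms(3,4)] assms(3,4) by (auto simp: horizontal_strip_def)
  obtain R where R: "\<And>r. r \<ge> R \<Longrightarrow> mu r = 0"
    using partitions_eventually_zero[OF assms(1)] by blast
  obtain R' where R': "\<And>r. r \<ge> R' \<Longrightarrow> nu r = 0"
    using partitions_eventually_zero[OF assms(2)] by blast
  define Q where "Q = max R R'"
  have zero: "mu r = 0" "nu r = 0" if "r \<ge> Q" for r
    using that R R' by (auto simp: Q_def)
  then have lam_zero: "?lam r = 0" if "r \<ge> Suc Q" for r
    using that by (auto simp: rsk_def split: nat.split)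
  \<comment> \<open>The minimum belonging to row \<open>n\<close> enters only in row
    \<open>Suc n\<close>; the last summand is this pending correction, which vanishes at
    \<open>n = Q\<close>.\<close>
  have telescope: "(\<Sum>r<Suc n. ?lam r - mu r) = k + (\<Sum>r<n. nu r - kap r) + (max (mu n) (nu n) - mu n)" for n
  proof (induction n)
    case (Suc n)
    have "?lam (Suc n) - mu (Suc n) + (max (mu n) (nu n) - mu n) =
        (nu n - kap n) + (max (mu (Suc n)) (nu (Suc n)) - mu (Suc n))"
      using le(2,3)[of n] by (auto simp: rsk_Suc max_def min_def)
    then show ?case
      using Suc unfolding sum.lessThan_Suc by linarith
  qed (simp add: rsk_0)
  show ?thesis
    using telescope[of Q] zero[of Q]
    by (simp add: card_skew_cells[of "Suc Q" ?lam] card_skew_cells[of Q nu] lam_zero zero)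
qed

lemma skew_schur_rsk:
  assumes "mu \<in> partitions" "nu \<in> partitions" "kap \<in> partitions"
    and "horizontal_strip mu kap" "horizontal_strip nu kap"
  shows "skew_schur (rsk mu nu kap k) mu [b] = b ^ k * skew_schur nu kap [b]"
  using assms
  by (simp add: skew_schur_single rsk_partition rsk_strip card_rsk_cells power_add)

text \<open>By \<open>tau_single\<close> the exponent of \<open>c\<close> counts columns of odd
  length. With both upper arguments equal to \<open>mu\<close>, the local rule raises this count by
  exactly \<open>k\<close>, because the contributions of \<open>mu\<close> to successive pairs of
  rows telescope.\<close>

lemma tau_rsk:
  assumes mu: "mu \<in> partitions" and kap: "kap \<in> partitions" and strip: "horizontal_strip mu kap"
  shows "tau (rsk mu mu kap k) [c] = c ^ k * tau kap [c]"
proof -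
  let ?lam = "rsk mu mu kap k"
  have lam: "?lam \<in> partitions"
    using rsk_partition[OF mu mu strip strip] .
  have le: "kap r \<le> mu r" "mu (Suc r) \<le> kap r" for r
    using strip by (auto simp: horizontal_strip_def)
  obtain R where R: "\<And>r. r \<ge> R \<Longrightarrow> mu r = 0"
    using partitions_eventually_zero[OF mu] by blast
  have zero: "?lam r = 0" "kap r = 0" if "r \<ge> Suc R" for r
    using that R le(1)[of r] by (auto simp: rsk_def split: nat.split)
  have telescope: "(\<Sum>i<Suc n. ?lam (2 * i) - ?lam (Suc (2 * i))) + (mu (Suc (2 * n)) - kap (Suc (2 * n))) =
      k + (\<Sum>i<Suc n. kap (2 * i) - kap (Suc (2 * i)))" for n
  proof (induction n)
    case 0
    then show ?case
      using le[of 0] le[of 1] by (simp add: rsk_def)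
  next
    case (Suc n)
    have "?lam (2 * Suc n) - ?lam (Suc (2 * Suc n)) + (mu (Suc (2 * Suc n)) - kap (Suc (2 * Suc n))) =
        (mu (Suc (2 * n)) - kap (Suc (2 * n))) + (kap (2 * Suc n) - kap (Suc (2 * Suc n)))"
      using le[of "Suc (2 * n)"] le[of "2 * Suc n"] le[of "Suc (2 * Suc n)"]
      by (simp add: rsk_def)
    then show ?case
      using Suc unfolding sum.lessThan_Suc by linarith
  qed
  have "tau ?lam [c] = c ^ (\<Sum>i<Suc R. ?lam (2 * i) - ?lam (Suc (2 * i)))"
    by (rule tau_single[OF lam]) (use zero in auto)
  moreover have "tau kap [c] = c ^ (\<Sum>i<Suc R. kap (2 * i) - kap (Suc (2 * i)))"
    by (rule tau_single[OF kap]) (use zero in auto)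
  ultimately show ?thesis
    using telescope[of R] R[of "Suc (2 * R)"] by (simp add: power_add[symmetric])
qed

section \<open>The growth diagram\<close>

text \<open>The left neighbour of a diagonal point lies outside the half-space; its mirror image,
  the point below, stands in for it, which is why two arguments coincide there.\<close>

fun growth :: "(nat \<times> nat \<Rightarrow> nat) \<Rightarrow> nat \<Rightarrow> nat \<Rightarrow> nat \<Rightarrow> nat" where
  "growth w n 0 = empty_partition"
| "growth w n (Suc m) =
    (if n > Suc m then rsk (growth w (n - 1) (Suc m)) (growth w n m) (growth w (n - 1) m) (w (n, Suc m))
     else if n = Suc m then rsk (growth w n m) (growth w n m) (growth w m m) (w (n, n))
     else empty_partition)"

declare growth.simps(2) [simp del]

lemma growth_off_diagonal:
  "Suc m < n \<Longrightarrow> growth w n (Suc m) =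
    rsk (growth w (n - 1) (Suc m)) (growth w n m) (growth w (n - 1) m) (w (n, Suc m))"
  by (subst growth.simps(2)) simp

lemma growth_diagonal:
  "growth w (Suc m) (Suc m) =
    rsk (growth w (Suc m) m) (growth w (Suc m) m) (growth w m m) (w (Suc m, Suc m))"
  by (subst growth.simps(2)) simp

text \<open>The claims need a joint induction: the local rule at a point uses the strips from its
  lower left neighbour into the two adjacent points, and supplies those into the new point.\<close>

lemma growth_properties:
  "m \<le> n \<Longrightarrow> growth w n m \<in> partitions \<and>
    horizontal_strip (growth w (Suc n) m) (growth w n m) \<and>
    (m > 0 \<longrightarrow> horizontal_strip (growth w n m) (growth w n (m - 1)))"
proof (induction m arbitrary: n)
  case 0
  then show ?case by (simp add: horizontal_strip_def) (simp add: empty_partition_def)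
next
  case (Suc m)
  have up: "growth w n (Suc m) \<in> partitions \<and> horizontal_strip (growth w n (Suc m)) (growth w n m)"
    if "Suc m \<le> n" for n
    using that
  proof (induction n rule: dec_induct)
    case base
    then show ?case
      using Suc.IH[of m] Suc.IH[of "Suc m"]
      unfolding growth_diagonal by (simp add: rsk_partition rsk_strip)
  next
    case (step n)
    then have "horizontal_strip (growth w n (Suc m)) (growth w n m)"
      "horizontal_strip (growth w (Suc n) m) (growth w n m)"
      "growth w n (Suc m) \<in> partitions" "growth w (Suc n) m \<in> partitions"
      using Suc.IH[of n] Suc.IH[of "Suc n"] by auto
    then show ?case
      using step growth_off_diagonal[of m "Suc n" w] by (simp add: rsk_partition rsk_strip)
  qed
  have "horizontal_strip (growth w n (Suc m)) (growth w n m)"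
    "horizontal_strip (growth w (Suc n) m) (growth w n m)"
    using up[OF Suc.prems] Suc.IH[of n] Suc.prems by auto
  then show ?case
    using up[OF Suc.prems] growth_off_diagonal[of m "Suc n" w] Suc.prems by (simp add: rsk_strip)
qed

text \<open>Row \<open>0\<close> of the local rule is \<open>max (mu 0) (nu 0) + k\<close>, the
  recursion of the passage times; on the diagonal the two values in the maximum coincide.\<close>

lemma growth_first_row: "m \<le> n \<Longrightarrow> growth w n m 0 = half_space_LPP w n m"
proof (induction w n m rule: half_space_LPP.induct)
  case (1 w n)
  then show ?case by (simp add: empty_partition_def)
next
  case (2 w n m)
  show ?case
  proof (cases "Suc m < n")
    case True
    then have "growth w (n - 1) (Suc m) 0 = half_space_LPP w (n - 1) (Suc m)"
      "growth w n m 0 = half_space_LPP w n m"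
      using "2.IH" by auto
    then show ?thesis
      using True growth_off_diagonal[OF True, of w] half_space_LPP.simps(2)[of w n m]
      by (simp only: rsk_0 if_True add.commute)
  next
    case False
    then have n: "n = Suc m" using "2.prems" by simp
    then have "growth w n m 0 = half_space_LPP w n m"
      using "2.IH"(3) by simp
    then show ?thesis
      using growth_diagonal[of w m] half_space_LPP.simps(2)[of w n m] n
      by (simp only: rsk_0 if_True if_False less_irrefl max.idem add.commute simp_thms)
  qed
qed

section \<open>Paths and the growth diagram below them\<close>

text \<open>A path is recorded by the heights \<open>h t\<close> of its vertices on the lines \<open>x - y = t\<close>, so that its
  vertices are the points \<open>(h t + t, h t)\<close>.\<close>

definition profile :: "(nat \<Rightarrow> nat) \<Rightarrow> nat \<Rightarrow> bool" where
  "profile h L \<longleftrightarrow> (\<forall>t. h (Suc t) \<le> h t \<and> h t \<le> Suc (h (Suc t))) \<and> (\<forall>t\<ge>L. h t = 0)"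

definition path_growth :: "(nat \<times> nat \<Rightarrow> nat) \<Rightarrow> (nat \<Rightarrow> nat) \<Rightarrow> nat \<Rightarrow> nat \<Rightarrow> nat" where
  "path_growth w h t = growth w (h t + t) (h t)"

definition step_weight ::
  "(nat \<Rightarrow> real) \<Rightarrow> (nat \<Rightarrow> nat) \<Rightarrow> nat \<Rightarrow> (nat \<Rightarrow> nat) \<Rightarrow> (nat \<Rightarrow> nat) \<Rightarrow> real" where
  "step_weight a h t alpha beta =
    (if h (Suc t) = h t then skew_schur beta alpha [a (h t + Suc t)]
     else skew_schur alpha beta [a (h t)])"

definition path_weight ::
  "real \<Rightarrow> (nat \<Rightarrow> real) \<Rightarrow> (nat \<Rightarrow> nat) \<Rightarrow> nat \<Rightarrow> (nat \<Rightarrow> nat \<Rightarrow> nat) \<Rightarrow> real" where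
  "path_weight c a h L x = tau (x 0) [c] * (\<Prod>t<L. step_weight a h t (x t) (x (Suc t)))"

text \<open>\<open>Y\<close> is compared with the height of the path on the line through
  \<open>(X, Y)\<close> parallel to the diagonal. These are the boxes whose weights determine the
  partitions on the path.\<close>

definition points_below :: "(nat \<Rightarrow> nat) \<Rightarrow> (nat \<times> nat) set" where
  "points_below h = {(X, Y). 1 \<le> Y \<and> Y \<le> X \<and> Y \<le> h (X - Y)}"

definition weight_parameter :: "real \<Rightarrow> (nat \<Rightarrow> real) \<Rightarrow> nat \<times> nat \<Rightarrow> real" where
  "weight_parameter c a v = (if fst v = snd v then c * a (fst v) else a (fst v) * a (snd v))"

lemma profile_step:
  assumes "profile h L"
  shows "h (Suc t) = h t \<or> h t = Suc (h (Suc t))"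
  using assms unfolding profile_def by (metis le_antisym not_less_eq_eq)

lemma finite_points_below:
  assumes "profile h L"
  shows "finite (points_below h)"
proof (rule finite_subset)
  show "points_below h \<subseteq> (\<lambda>(t, Y). (Y + t, Y)) ` Sigma {..<L} (\<lambda>t. {..h t})"
  proof
    fix v assume "v \<in> points_below h"
    then obtain X Y where v: "v = (X, Y)" "1 \<le> Y" "Y \<le> X" "Y \<le> h (X - Y)"
      by (auto simp: points_below_def)
    then have "X - Y < L"
      using assms by (metis profile_def leI not_one_le_zero order_trans)
    then show "v \<in> (\<lambda>(t, Y). (Y + t, Y)) ` Sigma {..<L} (\<lambda>t. {..h t})"
      using v by (intro image_eqI[of _ _ "(X - Y, Y)"]) auto
  qed
qed auto

lemma path_growth_partitions: "path_growth w h t \<in> partitions"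
  using growth_properties[of "h t" "h t + t" w] by (simp add: path_growth_def)

lemma path_growth_empty: "profile h L \<Longrightarrow> t \<ge> L \<Longrightarrow> path_growth w h t = empty_partition"
  by (simp add: path_growth_def profile_def)

lemma tau_empty: "tau empty_partition [c] = 1"
  using tau_single[OF empty_partition_in_partitions, of 0 c] by (simp add: empty_partition_def)

lemma skew_schur_empty: "skew_schur empty_partition empty_partition [b] = 1"
proof -
  have "skew_cells empty_partition empty_partition = {}"
    by (auto simp: skew_cells_def empty_partition_def)
  then show ?thesis
    by (simp add: skew_schur_single horizontal_strip_def) (simp add: empty_partition_def)
qed

text \<open>Along the axis a nonzero step weight requires \<open>x t \<le> x (Suc t)\<close>, so a
  nonempty partition cannot shrink to the empty one reached at \<open>L\<close>. Base case of the
  induction on the area below the path.\<close>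

lemma path_weight_zero_profile:
  assumes h: "\<And>t. h t = 0" and x: "\<And>t. t \<ge> L \<Longrightarrow> x t = empty_partition"
  shows "path_weight c a h L x = (if x = (\<lambda>_. empty_partition) then 1 else 0)"
proof (cases "x = (\<lambda>_. empty_partition)")
  case True
  then show ?thesis
    by (simp add: path_weight_def step_weight_def h tau_empty skew_schur_empty)
next
  case False
  define A where "A = {s. x s \<noteq> empty_partition}"
  define t where "t = Max A"
  have "A \<subseteq> {..<L}" using x by (force simp: A_def not_less[symmetric])
  then have "finite A" by (rule finite_subset) simp
  moreover have "A \<noteq> {}" using False by (auto simp: A_def)
  ultimately have "t \<in> A" "\<And>u. u \<in> A \<Longrightarrow> u \<le> t" by (auto simp: t_def)
  then have t: "x t \<noteq> empty_partition" "x (Suc t) = empty_partition"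
    by (auto simp: A_def) (metis Suc_n_not_le_n)
  then have "t < L" using x not_less by blast
  moreover have "step_weight a h t (x t) (x (Suc t)) = 0"
    using t by (simp add: step_weight_def h skew_schur_def)
  ultimately show ?thesis
    using False by (force simp: path_weight_def prod_zero_iff)
qed

text \<open>A corner of the path at height \<open>h t\<close>: the path \<open>h(t := h t - 1)\<close> avoids it, and the vertex
  before the corner is read off as the vertex after it when the corner is on the diagonal, where
  the local rule is applied with \<open>mu = nu\<close>.\<close>

locale corner =
  fixes h :: "nat \<Rightarrow> nat" and L t :: nat
  assumes profile: "profile h L"
    and descent: "h t = Suc (h (Suc t))"
    and flat: "t > 0 \<Longrightarrow> h (t - 1) = h t"
begin

definition cut :: "nat \<Rightarrow> nat" where "cut = h(t := h t - 1)"
definition before :: nat where "before = (if t = 0 then 1 else t - 1)"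
definition vertex :: "nat \<times> nat" where "vertex = (h t + t, h t)"

lemma t_less: "t < L"
  using profile descent unfolding profile_def by (metis leI nat.distinct(1))

lemma before_diagonal: "t = 0 \<Longrightarrow> before = Suc t"
  unfolding before_def by simp

lemma before_neq: "before \<noteq> t"
  by (auto simp: before_def)

lemma profile_cut: "profile cut L"
  unfolding profile_def
proof (intro conjI allI impI)
  fix s
  have "h (Suc s) \<le> h s \<and> h s \<le> Suc (h (Suc s))"
    using profile by (simp add: profile_def)
  then show "cut (Suc s) \<le> cut s" "cut s \<le> Suc (cut (Suc s))"
    using descent flat by (auto simp: cut_def)
next
  fix s assume "L \<le> s"
  then show "cut s = 0" using profile by (auto simp: cut_def profile_def)
qed

lemma sum_cut: "(\<Sum>s<L. cut s) < (\<Sum>s<L. h s)"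
  using t_less descent by (intro sum_strict_mono_ex1) (auto simp: cut_def)

lemma points_below_corner: "points_below h = insert vertex (points_below cut)"
proof -
  have "(X, Y) = vertex \<or> (X, Y) \<in> points_below cut" if "(X, Y) \<in> points_below h" for X Y
  proof (cases "X - Y = t \<and> Y = h t")
    case True
    then show ?thesis using that by (auto simp: points_below_def vertex_def)
  next
    case False
    then show ?thesis using that by (auto simp: points_below_def cut_def)
  qed
  moreover have "vertex \<in> points_below h"
    using descent by (auto simp: points_below_def vertex_def)
  moreover have "points_below cut \<subseteq> points_below h"
    by (auto simp: points_below_def cut_def split: if_splits)
  ultimately show ?thesis by auto
qed

lemma vertex_notin: "vertex \<notin> points_below cut"
  using descent by (auto simp: points_below_def vertex_def cut_def)

lemma path_growth_cut: "s \<noteq> t \<Longrightarrow> path_growth w cut s = path_growth w h s"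
  by (simp add: path_growth_def cut_def)

lemma
  shows path_growth_corner: "path_growth w h t =
      rsk (path_growth w h before) (path_growth w h (Suc t)) (path_growth w cut t) (w vertex)"
    and path_growth_strips:
      "horizontal_strip (path_growth w h before) (path_growth w cut t)"
      "horizontal_strip (path_growth w h (Suc t)) (path_growth w cut t)"
proof -
  define Y where "Y = h (Suc t)"
  have next_vertex: "path_growth w h (Suc t) = growth w (Suc (Y + t)) Y"
    and cut_vertex: "path_growth w cut t = growth w (Y + t) Y"
    and this_vertex: "path_growth w h t = growth w (Suc (Y + t)) (Suc Y)"
    by (simp_all add: path_growth_def cut_def Y_def descent)
  show "horizontal_strip (path_growth w h (Suc t)) (path_growth w cut t)"
    using growth_properties[of Y "Y + t" w] by (simp add: next_vertex cut_vertex)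
  show "path_growth w h t =
      rsk (path_growth w h before) (path_growth w h (Suc t)) (path_growth w cut t) (w vertex)"
    "horizontal_strip (path_growth w h before) (path_growth w cut t)"
  proof (atomize (full), cases "t = 0")
    case True
    then have "before = Suc t" by (rule before_diagonal)
    moreover have "vertex = (Suc Y, Suc Y)"
      unfolding vertex_def using True descent by (simp add: Y_def)
    ultimately show "path_growth w h t =
        rsk (path_growth w h before) (path_growth w h (Suc t)) (path_growth w cut t) (w vertex) \<and>
        horizontal_strip (path_growth w h before) (path_growth w cut t)"
      using growth_diagonal[of w Y] next_vertex cut_vertex this_vertex
        growth_properties[of Y "Y + t" w] True
      by (simp only: add_0_right)
  next
    case False
    then have "h (t - 1) = Suc Y"
      using flat descent by (simp add: Y_def)
    then have prev: "path_growth w h before = growth w (Y + t) (Suc Y)"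
      using False by (simp add: before_def path_growth_def)
    have "vertex = (Suc (Y + t), Suc Y)"
      using descent by (simp add: vertex_def Y_def)
    then show "path_growth w h t =
        rsk (path_growth w h before) (path_growth w h (Suc t)) (path_growth w cut t) (w vertex) \<and>
        horizontal_strip (path_growth w h before) (path_growth w cut t)"
      using growth_off_diagonal[of Y "Suc (Y + t)" w] False
        growth_properties[of "Suc Y" "Y + t" w]
      by (simp add: prev next_vertex cut_vertex this_vertex)
  qed
qed

lemma step_weight_other:
  assumes "s \<noteq> t" "t > 0 \<Longrightarrow> s \<noteq> t - 1"
  shows "step_weight a cut s = step_weight a h s"
proof -
  have "cut s = h s" "cut (Suc s) = h (Suc s)"
    using assms by (auto simp: cut_def)
  then show ?thesis by (simp add: step_weight_def fun_eq_iff)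
qed

lemma step_weight_corner:
  "step_weight a h t alpha beta = skew_schur alpha beta [a (h t)]"
  "step_weight a cut t alpha beta = skew_schur beta alpha [a (h t + t)]"
  "t > 0 \<Longrightarrow> step_weight a h (t - 1) alpha beta = skew_schur beta alpha [a (h t + t)]"
  "t > 0 \<Longrightarrow> step_weight a cut (t - 1) alpha beta = skew_schur alpha beta [a (h t)]"
  using descent flat by (auto simp: step_weight_def cut_def)

text \<open>Only the factors at the corner change. Off the diagonal the two edges give
  \<open>a (h t) ^ k\<close> and \<open>a (h t + t) ^ k\<close>; on it \<open>tau\<close> gives
  \<open>c ^ k\<close> and the single edge gives \<open>a (h t) ^ k\<close>.\<close>

lemma path_weight_corner:
  assumes x: "\<And>s. x s \<in> partitions" and kap: "kap \<in> partitions"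
    and strips: "horizontal_strip (x before) kap" "horizontal_strip (x (Suc t)) kap"
    and xt: "x t = rsk (x before) (x (Suc t)) kap k"
  shows "path_weight c a h L x =
    weight_parameter c a vertex ^ k * path_weight c a cut L (x(t := kap))"
proof (cases "t = 0")
  case True
  let ?y = "x(t := kap)"
  have remove: "(\<Prod>s<L. f s) = f t * (\<Prod>s\<in>{..<L} - {t}. f s)" for f :: "nat \<Rightarrow> real"
    using t_less by (simp add: prod.remove)
  have zero: "x 0 = x t" "?y 0 = kap" using True by simp_all
  have before: "before = Suc t" using True by (rule before_diagonal)
  have "Suc s \<noteq> t" "s \<noteq> t \<Longrightarrow> step_weight a cut s = step_weight a h s" for s
    using True step_weight_other[of s a] by simp_all
  then have rest: "(\<Prod>s\<in>{..<L} - {t}. step_weight a h s (x s) (x (Suc s))) =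
      (\<Prod>s\<in>{..<L} - {t}. step_weight a cut s (?y s) (?y (Suc s)))"
    by (intro prod.cong) auto
  have "path_weight c a h L x = tau (x t) [c] * (skew_schur (x t) (x (Suc t)) [a (h t)] *
      (\<Prod>s\<in>{..<L} - {t}. step_weight a h s (x s) (x (Suc s))))"
    unfolding path_weight_def remove zero step_weight_corner by simp
  also have "\<dots> = (c ^ k * tau kap [c]) * (a (h t) ^ k * skew_schur (x (Suc t)) kap [a (h t)] *
      (\<Prod>s\<in>{..<L} - {t}. step_weight a cut s (?y s) (?y (Suc s))))"
    using tau_rsk[OF x kap strips(2), of k c] skew_schur_rsk[OF x x kap strips(2,2), of k "a (h t)"]
    by (simp only: xt before rest)
  also have "\<dots> = weight_parameter c a vertex ^ k * path_weight c a cut L ?y"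
    unfolding path_weight_def remove zero step_weight_corner weight_parameter_def vertex_def
    using True by (simp add: power_mult_distrib)
  finally show ?thesis .
next
  case False
  let ?y = "x(t := kap)" and ?u = "t - 1"
  have before: "before = ?u" using False by (simp add: before_def)
  have u: "Suc ?u = t" "?u \<noteq> t" and pos: "t > 0" using False by auto
  have rest: "(\<Prod>s\<in>{..<L} - {t} - {?u}. step_weight a h s (x s) (x (Suc s))) =
      (\<Prod>s\<in>{..<L} - {t} - {?u}. step_weight a cut s (?y s) (?y (Suc s)))" (is "_ = ?rest")
    using False by (intro prod.cong) (auto simp: step_weight_other)
  have remove: "(\<Prod>s<L. f s) = f t * (f ?u * (\<Prod>s\<in>{..<L} - {t} - {?u}. f s))" for f :: "nat \<Rightarrow> real"
    using t_less u by (simp add: prod.remove[of "{..<L}" t] prod.remove[of "{..<L} - {t}" ?u])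
  have "path_weight c a h L x = tau (x 0) [c] * (skew_schur (x t) (x (Suc t)) [a (h t)] *
      (skew_schur (x t) (x ?u) [a (h t + t)] * ?rest))"
    unfolding path_weight_def remove rest u(1) step_weight_corner(1) step_weight_corner(3)[OF pos] ..
  \<comment> \<open>Each skew Schur factor is carried to the opposite side of the box: the vertical
    edge after the corner to the one before the cut vertex, and the horizontal edge likewise to the
    one after it.\<close>
  also have "\<dots> = tau (x 0) [c] * (a (h t) ^ k * skew_schur (x ?u) kap [a (h t)] *
      (a (h t + t) ^ k * skew_schur (x (Suc t)) kap [a (h t + t)] * ?rest))"
    using skew_schur_rsk[OF x x kap strips, of k "a (h t + t)"]
      skew_schur_rsk[OF x x kap strips(2,1), of k "a (h t)"]
    by (simp only: xt before rsk_commute[of "x (Suc t)"])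
  also have "\<dots> = weight_parameter c a vertex ^ k * path_weight c a cut L ?y"
    unfolding path_weight_def remove u(1) step_weight_corner(2) step_weight_corner(4)[OF pos]
    using pos u(2) by (simp add: weight_parameter_def vertex_def power_mult_distrib)
  finally show ?thesis .
qed

text \<open>A pair that is not a horizontal strip kills the one-variable factor of its edge. On the
  diagonal \<open>before\<close> is \<open>Suc t\<close>, so the single edge decides.\<close>

lemma path_weight_eq_0:
  assumes x: "\<And>s. x s \<in> partitions"
    and "\<not> (horizontal_strip (x t) (x before) \<and> horizontal_strip (x t) (x (Suc t)))"
  shows "path_weight c a h L x = 0"
proof -
  have "\<exists>s<L. step_weight a h s (x s) (x (Suc s)) = 0"
  proof (cases "horizontal_strip (x t) (x (Suc t))")
    case True
    then have "t > 0" "\<not> horizontal_strip (x t) (x (t - 1))"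
      using assms(2) by (auto simp: before_def split: if_splits)
    then show ?thesis
      using t_less x by (intro exI[of _ "t - 1"])
        (auto simp: step_weight_corner skew_schur_single simp del: One_nat_def)
  next
    case False
    then show ?thesis
      using t_less x by (intro exI[of _ t]) (auto simp: step_weight_corner skew_schur_single)
  qed
  then show ?thesis by (force simp: path_weight_def prod_zero_iff)
qed

end

section \<open>Recovering the weights from the partitions on a path\<close>

text \<open>A profile that is not zero must descend; at its first descent, counted from the
  diagonal, the preceding step is flat.\<close>

lemma corner_exists:
  assumes "profile h L" "h s \<noteq> 0"
  obtains t where "corner h L t"
proof -
  have "\<exists>t. h (Suc t) \<noteq> h t"
  proof (rule ccontr)
    assume "\<nexists>t. h (Suc t) \<noteq> h t"
    then have const: "h t = h 0" for t by (induction t) auto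
    then have "h s = h L" by metis
    then show False using assms by (simp add: profile_def)
  qed
  then obtain t where t: "h (Suc t) \<noteq> h t" "\<And>u. u < t \<Longrightarrow> h (Suc u) = h u"
    using exists_least_iff[of "\<lambda>t. h (Suc t) \<noteq> h t"] by blast
  have "corner h L t"
  proof
    show "h t = Suc (h (Suc t))" using t(1) profile_step[OF assms(1), of t] by auto
    show "h (t - 1) = h t" if "t > 0" using t(2)[of "t - 1"] that by simp
  qed fact
  then show ?thesis ..
qed

text \<open>At a corner the inverse local rule recovers the weight in the box and the partition at
  the cut vertex; this repeats until the path is the axis. A sequence that violates a strip
  condition on the way, or is not empty at the end, is never attained and has weight zero.\<close>

lemma path_growth_fiber:
  assumes "profile h L" "\<And>t. x t \<in> partitions" "\<And>t. t \<ge> L \<Longrightarrow> x t = empty_partition"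
  shows "path_weight c a h L x = 0 \<and> (\<forall>w. path_growth w h \<noteq> x) \<or>
    (\<exists>K. (\<forall>w. path_growth w h = x \<longleftrightarrow> (\<forall>v\<in>points_below h. w v = K v)) \<and>
      path_weight c a h L x = (\<Prod>v\<in>points_below h. weight_parameter c a v ^ K v))"
  using assms
proof (induction "\<Sum>s<L. h s" arbitrary: h x rule: less_induct)
  case (less h x)
  show ?case
  proof (cases "\<forall>t. h t = 0")
    case True
    then have "points_below h = {}" "path_growth w h = (\<lambda>_. empty_partition)" for w
      by (auto simp: points_below_def path_growth_def)
    then show ?thesis
      using path_weight_zero_profile[of h L x c a] True less.prems(3) by auto
  next
    case False
    then obtain t where "corner h L t"
      using corner_exists[OF less.prems(1)] by blast
    then interpret corner h L t .
    show ?thesis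
    proof (cases "horizontal_strip (x t) (x before) \<and> horizontal_strip (x t) (x (Suc t))")
      case False
      have "path_growth w h \<noteq> x" for w
        using False path_growth_corner[of w] rsk_strip[OF path_growth_strips[of w], of "w vertex"]
        by metis
      then show ?thesis
        using path_weight_eq_0[OF less.prems(2) False] by blast
    next
      case True
      then obtain kap k where kap: "kap \<in> partitions" "horizontal_strip (x before) kap"
          "horizontal_strip (x (Suc t)) kap" "rsk (x before) (x (Suc t)) kap k = x t"
        using rsk_surj[OF less.prems(2)] by metis
      let ?y = "x(t := kap)"
      have weight: "path_weight c a h L x =
          weight_parameter c a vertex ^ k * path_weight c a cut L ?y"
        using path_weight_corner[OF less.prems(2) kap(1-3) kap(4)[symmetric]] .
      have growth: "path_growth w h = x \<longleftrightarrow> path_growth w cut = ?y \<and> w vertex = k" for w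
      proof
        assume eq: "path_growth w h = x"
        then have "rsk (x before) (x (Suc t)) (path_growth w cut t) (w vertex) =
            rsk (x before) (x (Suc t)) kap k"
          using path_growth_corner[of w] kap(4) by simp
        then have "path_growth w cut t = kap" "w vertex = k"
          using rsk_inj[OF path_growth_strips[of w, unfolded eq] kap(2,3)] by auto
        then show "path_growth w cut = ?y \<and> w vertex = k"
          using eq path_growth_cut[of _ w] by (auto simp: fun_eq_iff)
      next
        assume cut: "path_growth w cut = ?y \<and> w vertex = k"
        then have other: "path_growth w h s = x s" if "s \<noteq> t" for s
          using that path_growth_cut[of s w] by simp
        have "path_growth w h t = x t"
          using path_growth_corner[of w] kap(4) cut other[OF before_neq] other[of "Suc t"] by simp
        then show "path_growth w h = x"
          using other by (intro ext) (metis ext)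
      qed
      have "?y s \<in> partitions" for s
        using less.prems(2) kap(1) by simp
      moreover have "?y s = empty_partition" if "s \<ge> L" for s
        using that less.prems(3) t_less by simp
      ultimately show ?thesis
        using less.hyps[OF sum_cut profile_cut, of ?y]
      proof (elim disjE exE meta_impE)
        assume "path_weight c a cut L ?y = 0 \<and> (\<forall>w. path_growth w cut \<noteq> ?y)"
        then show ?thesis using weight growth by simp
      next
        fix K
        assume K: "(\<forall>w. path_growth w cut = ?y \<longleftrightarrow> (\<forall>v\<in>points_below cut. w v = K v)) \<and>
          path_weight c a cut L ?y = (\<Prod>v\<in>points_below cut. weight_parameter c a v ^ K v)"
        let ?K = "K(vertex := k)"
        have same: "?K v = K v" if "v \<in> points_below cut" for v
          using that vertex_notin by auto
        have "path_growth w h = x \<longleftrightarrow> (\<forall>v\<in>points_below h. w v = ?K v)" for w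
          unfolding growth points_below_corner using K same by auto
        moreover have "path_weight c a h L x =
            (\<Prod>v\<in>points_below h. weight_parameter c a v ^ ?K v)"
          unfolding weight points_below_corner
          using K same vertex_notin finite_points_below[OF profile_cut] by simp
        ultimately show ?thesis by blast
      qed
    qed
  qed
qed

section \<open>The law of the growth diagram along a path\<close>

text \<open>The probabilities \<open>C * w x\<close> sum to one, so the total weight is
  \<open>1 / C\<close> and dividing by it returns the law of \<open>X\<close>. Being a multiple of a
  probability, \<open>w\<close> is nonnegative on \<open>A\<close>, hence \<open>ennreal\<close>
  does not truncate it.\<close>

lemma proportional_measure_eq_distr:
  assumes "prob_space M" and A: "countable A" and X: "X \<in> space M \<rightarrow> A"
    and C: "C > 0"
    and X_law: "\<forall>x\<in>A. {\<omega> \<in> space M. X \<omega> = x} \<in> sets M \<and>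
      measure M {\<omega> \<in> space M. X \<omega> = x} = C * w x"
  shows "X \<in> M \<rightarrow>\<^sub>M count_space A" "proportional_measure A w = distr M (count_space A) X"
proof -
  interpret prob_space M by fact
  have event: "{\<omega> \<in> space M. X \<omega> = x} \<in> sets M"
    and law: "measure M {\<omega> \<in> space M. X \<omega> = x} = C * w x" if "x \<in> A" for x
    using X_law that by auto
  have vimage: "X -` {x} \<inter> space M = {\<omega> \<in> space M. X \<omega> = x}" for x by auto
  show meas: "X \<in> M \<rightarrow>\<^sub>M count_space A"
  proof (rule measurableI)
    fix S assume "S \<in> sets (count_space A)"
    then have "S \<subseteq> A" by simp
    moreover have "X -` S \<inter> space M = (\<Union>x\<in>S. {\<omega> \<in> space M. X \<omega> = x})" by auto
    ultimately show "X -` S \<inter> space M \<in> sets M"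
      using countable_subset[OF _ A] event by (auto intro!: sets.countable_UN'')
  qed (use X in auto)
  let ?D = "distr M (count_space A) X"
  let ?Z = "\<integral>\<^sup>+ y. ennreal (w y) \<partial>count_space A"
  have point: "emeasure ?D {x} = ennreal C * ennreal (w x)" if "x \<in> A" for x
    using that C law[OF that]
    by (simp add: emeasure_distr[OF meas] vimage emeasure_eq_measure ennreal_mult')
  have "1 = emeasure ?D A"
    using prob_space_distr[OF meas, THEN prob_space.emeasure_space_1] by simp
  also have "\<dots> = (\<integral>\<^sup>+ x. emeasure ?D {x} \<partial>count_space A)"
    using A by (intro emeasure_countable_singleton) auto
  also have "\<dots> = (\<integral>\<^sup>+ x. ennreal C * ennreal (w x) \<partial>count_space A)"
    by (intro nn_integral_cong) (simp add: point)
  also have "\<dots> = ennreal C * ?Z"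
    by (rule nn_integral_cmult) simp
  finally have "ennreal C * ?Z = 1" by simp
  then have "ennreal (1 / C) * (ennreal C * ?Z) = ennreal (1 / C)" by simp
  then have Z: "?Z = ennreal (1 / C)"
    using C by (simp add: mult.assoc[symmetric] ennreal_mult'[symmetric])
  show "proportional_measure A w = ?D"
  proof (rule measure_eqI_countable)
    fix x assume "x \<in> A"
    have w: "0 \<le> w x"
      using law[OF \<open>x \<in> A\<close>] C measure_nonneg[of M "{\<omega> \<in> space M. X \<omega> = x}"]
      by (simp add: zero_le_mult_iff)
    have "emeasure (proportional_measure A w) {x} = ennreal (w x) / ?Z"
      using \<open>x \<in> A\<close> unfolding proportional_measure_def
      by (subst emeasure_density) auto
    also have "\<dots> = ennreal C * ennreal (w x)"
      using C w unfolding Z by (simp add: divide_ennreal ennreal_mult'[symmetric] mult.commute)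
    finally show "emeasure (proportional_measure A w) {x} = emeasure ?D {x}"
      using point[OF \<open>x \<in> A\<close>] by simp
  qed (simp_all add: A proportional_measure_def)
qed

lemma measurable_nat_binop:
  fixes f f' :: "'a \<Rightarrow> nat"
  assumes "f \<in> M \<rightarrow>\<^sub>M count_space UNIV" "f' \<in> M \<rightarrow>\<^sub>M count_space UNIV"
  shows "(\<lambda>x. F (f x) (f' x)) \<in> M \<rightarrow>\<^sub>M count_space UNIV"
proof (rule measurable_compose_countable[OF _ assms(1)])
  show "(\<lambda>x. F i (f' x)) \<in> M \<rightarrow>\<^sub>M count_space UNIV" for i
    by (rule measurable_compose[OF assms(2)]) simp
qed

section \<open>Geometric weights and the law along a path\<close>

locale half_space_model = prob_space M
  for M :: "'w measure" +
  fixes g :: "nat \<times> nat \<Rightarrow> 'w \<Rightarrow> nat" and c :: real and a :: "nat \<Rightarrow> real"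
  assumes c_pos: "c > 0"
    and a_pos: "\<And>k. k \<ge> 1 \<Longrightarrow> a k > 0"
    and ca_less: "\<And>k. k \<ge> 1 \<Longrightarrow> c * a k < 1"
    and aa_less: "\<And>k l. k \<ge> 1 \<Longrightarrow> l \<ge> 1 \<Longrightarrow> k \<noteq> l \<Longrightarrow> a k * a l < 1"
    and indep: "indep_vars (\<lambda>_. count_space UNIV) g {(x, y). 1 \<le> y \<and> y \<le> x}"
    and law_off_diagonal: "\<And>x y. 1 \<le> y \<Longrightarrow> y < x \<Longrightarrow>
          distr M (count_space UNIV) (g (x, y)) = measure_pmf (Geom (a x * a y))"
    and law_diagonal: "\<And>x. 1 \<le> x \<Longrightarrow>
          distr M (count_space UNIV) (g (x, x)) = measure_pmf (Geom (c * a x))"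
begin

definition Lam :: "'w \<Rightarrow> nat \<Rightarrow> nat \<Rightarrow> nat \<Rightarrow> nat" where
  "Lam \<omega> = growth (\<lambda>v. g v \<omega>)"

definition path_Lam :: "(nat \<Rightarrow> nat) \<Rightarrow> 'w \<Rightarrow> nat \<Rightarrow> nat \<Rightarrow> nat" where
  "path_Lam h \<omega> = path_growth (\<lambda>v. g v \<omega>) h"

definition norm_const :: "(nat \<Rightarrow> nat) \<Rightarrow> real" where
  "norm_const h = (\<Prod>v\<in>points_below h. 1 - weight_parameter c a v)"

lemma weight_parameter_bounds:
  assumes "1 \<le> y" "y \<le> x"
  shows "0 < weight_parameter c a (x, y)" "weight_parameter c a (x, y) < 1"
  using assms c_pos a_pos ca_less aa_less[of x y] by (auto simp: weight_parameter_def)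

lemma measurable_g: "1 \<le> y \<Longrightarrow> y \<le> x \<Longrightarrow> g (x, y) \<in> M \<rightarrow>\<^sub>M count_space UNIV"
  using indep unfolding indep_vars_def by auto

lemma prob_g:
  assumes "1 \<le> y" "y \<le> x"
  shows "prob (g (x, y) -` {k} \<inter> space M) =
    (1 - weight_parameter c a (x, y)) * weight_parameter c a (x, y) ^ k"
proof -
  let ?q = "weight_parameter c a (x, y)"
  have "distr M (count_space UNIV) (g (x, y)) = measure_pmf (Geom ?q)"
    using assms law_off_diagonal[of y x] law_diagonal[of x]
    by (cases "x = y") (auto simp: weight_parameter_def)
  then have "measure (distr M (count_space UNIV) (g (x, y))) {k} = pmf (Geom ?q) k"
    by (simp add: pmf.rep_eq)
  also have "\<dots> = (1 - ?q) * ?q ^ k"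
    using weight_parameter_bounds[OF assms] by (simp add: Geom_def)
  finally show ?thesis
    using measurable_g[OF assms] by (simp add: measure_distr)
qed

lemma prob_weights:
  assumes "profile h L"
  shows "{\<omega> \<in> space M. \<forall>v\<in>points_below h. g v \<omega> = K v} \<in> events"
    "prob {\<omega> \<in> space M. \<forall>v\<in>points_below h. g v \<omega> = K v} =
      norm_const h * (\<Prod>v\<in>points_below h. weight_parameter c a v ^ K v)"
proof -
  let ?J = "points_below h" and ?I = "{(x, y). 1 \<le> y \<and> y \<le> (x :: nat)}"
  have J: "finite ?J" "?J \<subseteq> ?I"
    using finite_points_below[OF assms] by (auto simp: points_below_def)
  \<comment> \<open>An intersection over no indices is the whole type rather than
    \<open>space M\<close>, and \<open>indep_varsD\<close> asks for a nonempty index set; a path on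
    the axis is therefore a case of its own.\<close>
  have eq: "{\<omega> \<in> space M. \<forall>v\<in>?J. g v \<omega> = K v} =
      (if ?J = {} then space M else \<Inter>v\<in>?J. g v -` {K v} \<inter> space M)"
    by auto
  have event: "g v -` {K v} \<inter> space M \<in> events" if "v \<in> ?J" for v
    using that J measurable_g[of "snd v" "fst v"] by (auto intro!: measurable_sets)
  show "{\<omega> \<in> space M. \<forall>v\<in>?J. g v \<omega> = K v} \<in> events"
    unfolding eq using sets.finite_INT[OF J(1) _ event] by auto
  have "prob {\<omega> \<in> space M. \<forall>v\<in>?J. g v \<omega> = K v} = (\<Prod>v\<in>?J. prob (g v -` {K v} \<inter> space M))"
  proof (cases "?J = {}")
    case False
    then show ?thesis
      unfolding eq using indep_varsD[OF indep False J, of "\<lambda>v. {K v}"] by simp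
  qed (simp add: eq prob_space)
  also have "\<dots> = (\<Prod>v\<in>?J. (1 - weight_parameter c a v) * weight_parameter c a v ^ K v)"
    using J prob_g by (intro prod.cong) auto
  finally show "prob {\<omega> \<in> space M. \<forall>v\<in>?J. g v \<omega> = K v} =
      norm_const h * (\<Prod>v\<in>?J. weight_parameter c a v ^ K v)"
    by (simp add: norm_const_def prod.distrib)
qed

lemma norm_const_pos: "norm_const h > 0"
  unfolding norm_const_def
  by (intro prod_pos) (auto simp: points_below_def weight_parameter_bounds)

lemma prob_path:
  assumes "profile h L" "\<And>t. x t \<in> partitions" "\<And>t. t \<ge> L \<Longrightarrow> x t = empty_partition"
  shows "{\<omega> \<in> space M. path_Lam h \<omega> = x} \<in> events"
    "prob {\<omega> \<in> space M. path_Lam h \<omega> = x} = norm_const h * path_weight c a h L x"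
proof (atomize (full))
  show "{\<omega> \<in> space M. path_Lam h \<omega> = x} \<in> events \<and>
      prob {\<omega> \<in> space M. path_Lam h \<omega> = x} = norm_const h * path_weight c a h L x"
  proof (cases "path_weight c a h L x = 0 \<and> (\<forall>w. path_growth w h \<noteq> x)")
    case True
    then show ?thesis by (simp add: path_Lam_def)
  next
    case False
    then obtain K where "\<forall>w. (path_growth w h = x) = (\<forall>v\<in>points_below h. w v = K v)"
      "path_weight c a h L x = (\<Prod>v\<in>points_below h. weight_parameter c a v ^ K v)"
      using path_growth_fiber[of h L x c a] assms by metis
    then show ?thesis
      using prob_weights[OF assms(1), of K] by (simp add: path_Lam_def)
  qed
qed

lemma measurable_rsk:
  assumes "\<And>r. (\<lambda>\<omega>. mu \<omega> r) \<in> M \<rightarrow>\<^sub>M count_space UNIV" "\<And>r. (\<lambda>\<omega>. nu \<omega> r) \<in> M \<rightarrow>\<^sub>M count_space UNIV"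
    "\<And>r. (\<lambda>\<omega>. kap \<omega> r) \<in> M \<rightarrow>\<^sub>M count_space UNIV" "k \<in> M \<rightarrow>\<^sub>M count_space UNIV"
  shows "(\<lambda>\<omega>. rsk (mu \<omega>) (nu \<omega>) (kap \<omega>) (k \<omega>) r) \<in> M \<rightarrow>\<^sub>M count_space UNIV"
  unfolding rsk_def
  by (cases r) (auto intro!: measurable_nat_binop[where F = "(+)"]
      measurable_nat_binop[where F = "(-)"] measurable_nat_binop[where F = max]
      measurable_nat_binop[where F = min] assms)

lemma measurable_Lam: "m \<le> n \<Longrightarrow> (\<lambda>\<omega>. Lam \<omega> n m r) \<in> M \<rightarrow>\<^sub>M count_space UNIV"
proof (induction m arbitrary: n r)
  case 0
  then show ?case by (simp add: Lam_def)
next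
  case (Suc m)
  show ?case
    using Suc.prems
  proof (induction n arbitrary: r rule: dec_induct)
    case base
    show ?case
      using Suc.IH unfolding Lam_def growth_diagonal
      by (intro measurable_rsk measurable_g) auto
  next
    case (step n)
    have "Lam \<omega> (Suc n) (Suc m) =
        rsk (Lam \<omega> n (Suc m)) (Lam \<omega> (Suc n) m) (Lam \<omega> n m) (g (Suc n, Suc m) \<omega>)" for \<omega>
      using step growth_off_diagonal[of m "Suc n" "\<lambda>v. g v \<omega>"] by (simp add: Lam_def)
    then show ?case
      using step Suc.IH by (auto intro!: measurable_rsk measurable_g)
  qed
qed

text \<open>The type of partitions is uncountable, so the event is written as a countable
  intersection over the rows.\<close>

lemma event_Lam:
  assumes "m \<le> n"
  shows "Measurable.pred M (\<lambda>\<omega>. Lam \<omega> n m = alpha)"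
proof -
  have "Measurable.pred M (\<lambda>\<omega>. Lam \<omega> n m r = alpha r)" for r
    using measurable_compose[OF measurable_Lam[OF assms], of "\<lambda>x. x = alpha r" "count_space UNIV" r]
    by simp
  then have "Measurable.pred M (\<lambda>\<omega>. \<forall>r. Lam \<omega> n m r = alpha r)"
    by measurable
  then show ?thesis by (simp add: fun_eq_iff)
qed

lemma path_Lam_eq: "path_Lam h \<omega> t = Lam \<omega> (h t + t) (h t)"
  by (simp add: path_Lam_def path_growth_def Lam_def)

lemma event_path_Lam [measurable]: "Measurable.pred M (\<lambda>\<omega>. path_Lam h \<omega> t = alpha)"
  unfolding path_Lam_eq by (rule event_Lam) simp

text \<open>\<open>marginal h L t E \<Psi>\<close> says that, on the event \<open>E\<close>, which will only concern the times before
  \<open>t\<close>, the process along the path from time \<open>t\<close> on has the initial weight \<open>\<Psi>\<close> and the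
  step weights of the path.\<close>

definition marginal ::
  "(nat \<Rightarrow> nat) \<Rightarrow> nat \<Rightarrow> nat \<Rightarrow> 'w set \<Rightarrow> ((nat \<Rightarrow> nat) \<Rightarrow> real) \<Rightarrow> bool" where
  "marginal h L t E Psi \<longleftrightarrow> E \<in> events \<and>
    (\<forall>x. (\<forall>s. x s \<in> partitions) \<longrightarrow> (\<forall>s\<ge>L. x s = empty_partition) \<longrightarrow>
      prob (E \<inter> {\<omega> \<in> space M. \<forall>s\<ge>t. path_Lam h \<omega> s = x s}) =
        norm_const h * Psi (x t) * (\<Prod>s\<in>{t..<L}. step_weight a h s (x s) (x (Suc s))))"

lemma marginal_cong:
  assumes "marginal h L t E Psi" "\<And>beta. beta \<in> partitions \<Longrightarrow> Psi beta = Psi' beta"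
  shows "marginal h L t E Psi'"
  using assms by (simp add: marginal_def)

lemma marginal_start:
  assumes "profile h L"
  shows "marginal h L 0 (space M) (\<lambda>beta. tau beta [c])"
  unfolding marginal_def
proof (intro conjI allI impI)
  fix x :: "nat \<Rightarrow> nat \<Rightarrow> nat"
  assume x: "\<forall>s. x s \<in> partitions" "\<forall>s\<ge>L. x s = empty_partition"
  have eq: "space M \<inter> {\<omega> \<in> space M. \<forall>s\<ge>0. path_Lam h \<omega> s = x s} = {\<omega> \<in> space M. path_Lam h \<omega> = x}"
    by (auto simp: fun_eq_iff)
  show "prob (space M \<inter> {\<omega> \<in> space M. \<forall>s\<ge>0. path_Lam h \<omega> s = x s}) =
      norm_const h * tau (x 0) [c] * (\<Prod>s = 0..<L. step_weight a h s (x s) (x (Suc s)))"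
    unfolding eq using prob_path(2)[OF assms, of x] x
    by (simp add: path_weight_def atLeast0LessThan)
qed simp

text \<open>Used at the corners, whose partitions stay visible: recording the value concentrates the
  initial weight and leaves the later steps alone.\<close>

lemma marginal_mark:
  assumes "marginal h L t E Psi"
  shows "marginal h L t (E \<inter> {\<omega> \<in> space M. path_Lam h \<omega> t = alpha})
    (\<lambda>beta. if beta = alpha then Psi alpha else 0)"
  unfolding marginal_def
proof (intro conjI allI impI)
  show "E \<inter> {\<omega> \<in> space M. path_Lam h \<omega> t = alpha} \<in> events"
    using assms by (auto simp: marginal_def)
  fix x :: "nat \<Rightarrow> nat \<Rightarrow> nat"
  assume x: "\<forall>s. x s \<in> partitions" "\<forall>s\<ge>L. x s = empty_partition"
  have "E \<inter> {\<omega> \<in> space M. path_Lam h \<omega> t = alpha} \<inter> {\<omega> \<in> space M. \<forall>s\<ge>t. path_Lam h \<omega> s = x s} =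
      (if x t = alpha then E \<inter> {\<omega> \<in> space M. \<forall>s\<ge>t. path_Lam h \<omega> s = x s} else {})"
    by auto
  then show "prob (E \<inter> {\<omega> \<in> space M. path_Lam h \<omega> t = alpha} \<inter>
        {\<omega> \<in> space M. \<forall>s\<ge>t. path_Lam h \<omega> s = x s}) =
      norm_const h * (if x t = alpha then Psi alpha else 0) *
        (\<Prod>s\<in>{t..<L}. step_weight a h s (x s) (x (Suc s)))"
    using assms x by (auto simp: marginal_def)
qed

text \<open>Sums out the partition at time \<open>t\<close>. Values outside the finite set
  \<open>F gam\<close> have probability zero and are countably many, so together they form a null
  set; the others are added up by finite additivity.\<close>

lemma marginal_step:
  assumes marginal: "marginal h L t E Psi" and "t < L"
    and F: "\<And>gam. gam \<in> partitions \<Longrightarrow> finite (F gam) \<and> F gam \<subseteq> partitions"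
    and zero: "\<And>beta gam. beta \<in> partitions \<Longrightarrow> gam \<in> partitions \<Longrightarrow> beta \<notin> F gam \<Longrightarrow>
      Psi beta * step_weight a h t beta gam = 0"
    and Psi': "\<And>gam. gam \<in> partitions \<Longrightarrow>
      Psi' gam = (\<Sum>beta\<in>F gam. Psi beta * step_weight a h t beta gam)"
  shows "marginal h L (Suc t) E Psi'"
  unfolding marginal_def
proof (intro conjI allI impI)
  show [measurable]: "E \<in> events" using marginal by (simp add: marginal_def)
  fix x :: "nat \<Rightarrow> nat \<Rightarrow> nat"
  assume x: "\<forall>s. x s \<in> partitions" "\<forall>s\<ge>L. x s = empty_partition"
  let ?gam = "x (Suc t)"
  let ?rest = "\<Prod>s\<in>{Suc t..<L}. step_weight a h s (x s) (x (Suc s))"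
  define A where "A beta = E \<inter> {\<omega> \<in> space M. \<forall>s\<ge>t. path_Lam h \<omega> s = (x(t := beta)) s}" for beta
  have A_event: "A beta \<in> events" for beta
  proof -
    have "{\<omega> \<in> space M. \<forall>s\<ge>t. path_Lam h \<omega> s = (x(t := beta)) s} \<in> events"
      by measurable
    then show ?thesis by (auto simp: A_def)
  qed
  have A_prob: "prob (A beta) = norm_const h * (Psi beta * step_weight a h t beta ?gam) * ?rest"
    if "beta \<in> partitions" for beta
  proof -
    let ?y = "x(t := beta)"
    have "prob (A beta) = norm_const h * Psi (?y t) *
        (\<Prod>s\<in>{t..<L}. step_weight a h s (?y s) (?y (Suc s)))"
      using marginal x that \<open>t < L\<close> unfolding A_def marginal_def by simp
    also have "(\<Prod>s\<in>{t..<L}. step_weight a h s (?y s) (?y (Suc s))) =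
        step_weight a h t beta ?gam * (\<Prod>s\<in>{Suc t..<L}. step_weight a h s (?y s) (?y (Suc s)))"
      using \<open>t < L\<close> by (subst prod.atLeast_Suc_lessThan) auto
    also have "(\<Prod>s\<in>{Suc t..<L}. step_weight a h s (?y s) (?y (Suc s))) = ?rest"
      by (intro prod.cong) auto
    finally show ?thesis by simp
  qed
  have disjoint: "disjoint_family_on A S" for S
    by (auto simp: disjoint_family_on_def A_def)
  have cover: "E \<inter> {\<omega> \<in> space M. \<forall>s\<ge>Suc t. path_Lam h \<omega> s = x s} = (\<Union>beta\<in>partitions. A beta)"
  proof (intro equalityI subsetI)
    fix \<omega> assume \<omega>: "\<omega> \<in> E \<inter> {\<omega> \<in> space M. \<forall>s\<ge>Suc t. path_Lam h \<omega> s = x s}"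
    have "\<forall>s\<ge>t. path_Lam h \<omega> s = (x(t := path_Lam h \<omega> t)) s"
      using \<omega> by (auto simp: Suc_le_eq)
    then have "\<omega> \<in> A (path_Lam h \<omega> t)"
      using \<omega> unfolding A_def by blast
    then show "\<omega> \<in> (\<Union>beta\<in>partitions. A beta)"
      using path_growth_partitions by (auto simp: path_Lam_def)
  next
    fix \<omega> assume "\<omega> \<in> (\<Union>beta\<in>partitions. A beta)"
    then obtain beta where "\<omega> \<in> A beta" by blast
    then have "\<omega> \<in> E" "\<omega> \<in> space M" "path_Lam h \<omega> s = x s" if "s \<ge> Suc t" for s
      using that by (auto simp: A_def dest!: spec[of _ s])
    then show "\<omega> \<in> E \<inter> {\<omega> \<in> space M. \<forall>s\<ge>Suc t. path_Lam h \<omega> s = x s}"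
      by blast
  qed
  have gam: "finite (F ?gam)" "F ?gam \<subseteq> partitions"
    using F x(1) by auto
  have "(\<Union>beta\<in>partitions - F ?gam. A beta) \<in> null_sets M"
  proof (rule null_sets_UN')
    show "countable (partitions - F ?gam)" using countable_partitions by blast
    fix beta assume "beta \<in> partitions - F ?gam"
    then show "A beta \<in> null_sets M"
      using A_event A_prob zero[of beta ?gam] x(1)
      by (auto simp: null_sets_def emeasure_eq_measure)
  qed
  moreover have "(\<Union>beta\<in>partitions. A beta) =
      (\<Union>beta\<in>F ?gam. A beta) \<union> (\<Union>beta\<in>partitions - F ?gam. A beta)"
    using gam(2) by blast
  moreover have "(\<Union>beta\<in>F ?gam. A beta) \<in> events"
    using gam(1) A_event by auto
  ultimately have "prob (\<Union>beta\<in>partitions. A beta) = prob (\<Union>beta\<in>F ?gam. A beta)"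
    by (simp add: measure_Un_null_set)
  also have "\<dots> = (\<Sum>beta\<in>F ?gam. prob (A beta))"
    using gam(1) A_event disjoint by (intro finite_measure_finite_Union) auto
  also have "\<dots> = (\<Sum>beta\<in>F ?gam. norm_const h * (Psi beta * step_weight a h t beta ?gam) * ?rest)"
    using gam(2) A_prob by (intro sum.cong) auto
  also have "\<dots> = norm_const h * Psi' ?gam * ?rest"
    using x(1) by (simp add: Psi' sum_distrib_left sum_distrib_right)
  finally show "prob (E \<inter> {\<omega> \<in> space M. \<forall>s\<ge>Suc t. path_Lam h \<omega> s = x s}) =
      norm_const h * Psi' ?gam * ?rest"
    unfolding cover .
qed

text \<open>Each step appends the variable indexed by the abscissa of its right end.
  \<open>Phi\<close> is abstract because it is \<open>tau\<close> on the first horizontal piece and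
  a multiple of a skew Schur function on the later ones.\<close>

lemma marginal_left:
  assumes branching: "\<And>gam rho b. gam \<in> partitions \<Longrightarrow> Phi gam (rho @ [b]) =
      (\<Sum>beta | beta \<in> partitions \<and> beta \<le> gam. Phi beta rho * skew_schur gam beta [b])"
    and "marginal h L t E (\<lambda>gam. Phi gam rho)"
    and "\<And>s. s \<le> m \<Longrightarrow> h (t + s) = y" "t + m \<le> L"
  shows "marginal h L (t + m) E (\<lambda>gam. Phi gam (rho @ map a [Suc (y + t)..<Suc (y + t + m)]))"
  using assms(3,4)
proof (induction m)
  case 0
  then show ?case using assms(2) by simp
next
  case (Suc m)
  have step: "step_weight a h (t + m) beta gam = skew_schur gam beta [a (Suc (y + t + m))]" for beta gam
    using Suc.prems(1)[of m] Suc.prems(1)[of "Suc m"] by (simp add: step_weight_def ac_simps)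
  have "marginal h L (t + m) E (\<lambda>gam. Phi gam (rho @ map a [Suc (y + t)..<Suc (y + t + m)]))"
    using Suc by simp
  then have "marginal h L (Suc (t + m)) E
      (\<lambda>gam. Phi gam ((rho @ map a [Suc (y + t)..<Suc (y + t + m)]) @ [a (Suc (y + t + m))]))"
  proof (rule marginal_step[where F = "\<lambda>gam. {beta \<in> partitions. beta \<le> gam}"])
    show "t + m < L" using Suc.prems by simp
  qed (auto simp: finite_partitions_below step branching skew_schur_eq_0 simp del: append_assoc)
  then show ?case by simp
qed

text \<open>The partitions shrink away from the fixed \<open>alpha\<close> while the index of the
  variable decreases, so each new variable goes to the front of the list and
  \<open>skew_schur_append\<close> is used with a singleton first part.\<close>

lemma marginal_down:
  assumes alpha: "alpha \<in> partitions"
    and "marginal h L t E (\<lambda>gam. A * skew_schur alpha gam [])"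
    and "\<And>s. s \<le> m \<Longrightarrow> h (t + s) = Y - s" "m \<le> Y" "t + m \<le> L"
  shows "marginal h L (t + m) E (\<lambda>gam. A * skew_schur alpha gam (map a [Suc (Y - m)..<Suc Y]))"
  using assms(3-5)
proof (induction m)
  case 0
  then show ?case using assms(2) by simp
next
  case (Suc m)
  let ?rho = "map a [Suc (Y - m)..<Suc Y]"
  have step: "step_weight a h (t + m) beta gam = skew_schur beta gam [a (Y - m)]" for beta gam
    using Suc.prems(1)[of m] Suc.prems(1)[of "Suc m"] Suc.prems(2) by (auto simp: step_weight_def)
  have list: "map a [Suc (Y - Suc m)..<Suc Y] = [a (Y - m)] @ ?rho"
    using Suc.prems(2) by (cases "m = 0") (auto simp: upt_conv_Cons Suc_diff_Suc)
  have "marginal h L (t + m) E (\<lambda>gam. A * skew_schur alpha gam ?rho)"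
    using Suc by simp
  then have "marginal h L (Suc (t + m)) E (\<lambda>gam. A * skew_schur alpha gam ([a (Y - m)] @ ?rho))"
  proof (rule marginal_step[where F = "\<lambda>gam. {beta \<in> partitions. beta \<le> alpha}"])
    show "t + m < L" using Suc.prems by simp
    show "finite {beta \<in> partitions. beta \<le> alpha} \<and> {beta \<in> partitions. beta \<le> alpha} \<subseteq> partitions"
      using finite_partitions_below[OF alpha] by auto
    show "A * skew_schur alpha beta ?rho * step_weight a h (t + m) beta gam = 0"
      if "beta \<in> partitions" "beta \<notin> {beta \<in> partitions. beta \<le> alpha}" for beta gam
      using that by (simp add: skew_schur_eq_0)
    show "A * skew_schur alpha gam ([a (Y - m)] @ ?rho) =
        (\<Sum>beta | beta \<in> partitions \<and> beta \<le> alpha.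
          A * skew_schur alpha beta ?rho * step_weight a h (t + m) beta gam)"
      if "gam \<in> partitions" for gam
      unfolding skew_schur_append[OF alpha that] step sum_distrib_left by (simp only: mult_ac)
  qed
  then show ?case unfolding list by simp
qed

text \<open>From time \<open>L\<close> on all partitions on the path are empty, so the condition on
  the remaining path is automatic and the product is empty.\<close>

lemma marginal_end:
  assumes "profile h L" "marginal h L L E Psi"
  shows "E \<in> events" "prob E = norm_const h * Psi empty_partition"
proof -
  show "E \<in> events" using assms(2) by (simp add: marginal_def)
  then have "E \<inter> {\<omega> \<in> space M. \<forall>s\<ge>L. path_Lam h \<omega> s = empty_partition} = E"
    using sets.sets_into_space path_growth_empty[OF assms(1)] by (auto simp: path_Lam_def)
  then show "prob E = norm_const h * Psi empty_partition"
    using assms(2)[unfolded marginal_def, THEN conjunct2, rule_format, of "\<lambda>_. empty_partition"]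
    by simp
qed

end

section \<open>The path through a down-right sequence of points\<close>

locale down_right_points =
  fixes n :: nat and i j :: "nat \<Rightarrow> nat"
  assumes n_pos: "n \<ge> 1"
    and i_increasing: "\<And>k. 1 \<le> k \<Longrightarrow> k < n \<Longrightarrow> i k < i (Suc k)"
    and j_decreasing: "\<And>k. 1 \<le> k \<Longrightarrow> k < n \<Longrightarrow> j k > j (Suc k)"
    and below_diagonal: "\<And>k. 1 \<le> k \<Longrightarrow> k \<le> n \<Longrightarrow> i k > j k"
begin

text \<open>The path from \<open>(j 1, j 1)\<close> to \<open>(i n, 0)\<close> with outer corners \<open>(i k, j k)\<close> bounds the union of
  the quadrants to the lower left of these corners.\<close>

definition height :: "nat \<Rightarrow> nat" where
  "height t = Max ((\<lambda>k. min (j k) (i k - t)) ` {1..n})"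

lemma i_mono:
  assumes "k \<le> l" "1 \<le> k" "l \<le> n"
  shows "i k \<le> i l"
  using assms
proof (induction l rule: dec_induct)
  case (step l)
  then show ?case using i_increasing[of l] by simp
qed simp

lemma j_antimono:
  assumes "k \<le> l" "1 \<le> k" "l \<le> n"
  shows "j l \<le> j k"
  using assms
proof (induction l rule: dec_induct)
  case (step l)
  then show ?case using j_decreasing[of l] by simp
qed simp

lemma height_ge: "k \<in> {1..n} \<Longrightarrow> min (j k) (i k - t) \<le> height t"
  unfolding height_def by (intro Max_ge) auto

lemma height_attained:
  obtains k where "k \<in> {1..n}" "height t = min (j k) (i k - t)"
proof -
  have "height t \<in> (\<lambda>k. min (j k) (i k - t)) ` {1..n}"
    unfolding height_def using n_pos by (intro Max_in) auto
  then show ?thesis using that by blast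
qed

lemma height_eqI:
  assumes "k \<in> {1..n}" "min (j k) (i k - t) = y"
    and "\<And>l. l \<in> {1..n} \<Longrightarrow> min (j l) (i l - t) \<le> y"
  shows "height t = y"
  unfolding height_def using assms by (intro Max_eqI) auto

lemma profile_height: "profile height (i n)"
  unfolding profile_def
proof (intro conjI allI impI)
  fix t
  obtain k where "k \<in> {1..n}" "height (Suc t) = min (j k) (i k - Suc t)"
    by (rule height_attained)
  then show "height (Suc t) \<le> height t"
    using height_ge[of k t] by auto
  obtain k where "k \<in> {1..n}" "height t = min (j k) (i k - t)"
    by (rule height_attained)
  then show "height t \<le> Suc (height (Suc t))"
    using height_ge[of k "Suc t"] by auto
next
  fix t assume "i n \<le> t"
  obtain k where "k \<in> {1..n}" "height t = min (j k) (i k - t)"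
    by (rule height_attained)
  then show "height t = 0"
    using \<open>i n \<le> t\<close> i_mono[of k n] by auto
qed

text \<open>The piece from the inner corner \<open>(i (k - 1), j k)\<close>, or from the diagonal if
  \<open>k = 1\<close>, to the outer corner \<open>(i k, j k)\<close>. Earlier corners lie too far
  left to matter here, later ones are lower.\<close>

lemma height_plateau:
  assumes k: "k \<in> {1..n}" and "k > 1 \<Longrightarrow> i (k - 1) - j k \<le> t" "t \<le> i k - j k"
  shows "height t = j k"
proof (rule height_eqI[OF k])
  show "min (j k) (i k - t) = j k"
    using assms below_diagonal[of k] by auto
  fix l assume l: "l \<in> {1..n}"
  show "min (j l) (i l - t) \<le> j k"
  proof (cases "l < k")
    case True
    then have "i l \<le> i (k - 1)" using l k by (intro i_mono) auto
    then show ?thesis using True l assms(2) by auto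
  next
    case False
    then show ?thesis using j_antimono[of k l] l k by auto
  qed
qed

text \<open>The piece from \<open>(i k, j k)\<close> down to the inner corner
  \<open>(i k, j (Suc k))\<close>, or to the axis if \<open>k = n\<close>.\<close>

lemma height_slope:
  assumes k: "k \<in> {1..n}" and "i k - j k \<le> t" "k < n \<Longrightarrow> t \<le> i k - j (Suc k)"
  shows "height t = i k - t"
proof (rule height_eqI[OF k])
  show "min (j k) (i k - t) = i k - t"
    using assms by auto
  fix l assume l: "l \<in> {1..n}"
  show "min (j l) (i l - t) \<le> i k - t"
  proof (cases "l \<le> k")
    case True
    then show ?thesis using i_mono[of l k] l k by auto
  next
    case False
    then have "j l \<le> j (Suc k)" using l k by (intro j_antimono) auto
    moreover have "j (Suc k) < i k"
      using False l k j_decreasing[of k] below_diagonal[of k] by auto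
    ultimately show ?thesis using False l assms(3) by auto
  qed
qed

end

lemma restrict_eq_PiE_iff:
  assumes "y \<in> Pi\<^sub>E I B"
  shows "restrict F I = y \<longleftrightarrow> (\<forall>k\<in>I. F k = y k)"
  using assms by (auto simp: PiE_iff extensional_def restrict_def fun_eq_iff)

locale half_space_points = half_space_model M g c a + down_right_points n i j
  for M :: "'w measure" and g :: "nat \<times> nat \<Rightarrow> 'w \<Rightarrow> nat" and c :: real and a :: "nat \<Rightarrow> real"
    and n :: nat and i j :: "nat \<Rightarrow> nat"
begin

section \<open>Summing out between the corners\<close>

text \<open>The Pfaffian Schur weight up to the factor that introduces the \<open>k\<close>-th
  partition, as a function of that partition. The update \<open>lam(k := gam)\<close> covers both
  \<open>k = 1\<close>, where \<open>gam\<close> enters \<open>tau\<close>, and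
  \<open>k > 1\<close>, where it enters the last factor.\<close>

definition partial_weight ::
  "nat \<Rightarrow> (nat \<Rightarrow> nat \<Rightarrow> nat) \<Rightarrow> (nat \<Rightarrow> nat \<Rightarrow> nat) \<Rightarrow> (nat \<Rightarrow> nat) \<Rightarrow> real" where
  "partial_weight k lam mu gam =
    tau ((lam(k := gam)) 1) (LPP_rho_plus c a i j 0) *
    (\<Prod>l\<in>{1..<k}. skew_schur (lam l) (mu l) (LPP_rho_minus a n j l) *
      skew_schur ((lam(k := gam)) (Suc l)) (mu l) (LPP_rho_plus c a i j l))"

text \<open>The times are those of the outer corner \<open>(i l, j l)\<close> and the inner corner
  \<open>(i l, j (Suc l))\<close>.\<close>

definition earlier_event ::
  "nat \<Rightarrow> (nat \<Rightarrow> nat \<Rightarrow> nat) \<Rightarrow> (nat \<Rightarrow> nat \<Rightarrow> nat) \<Rightarrow> 'w set" where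
  "earlier_event k lam mu = {\<omega> \<in> space M. \<forall>l\<in>{1..<k}.
    path_Lam height \<omega> (i l - j l) = lam l \<and> path_Lam height \<omega> (i l - j (Suc l)) = mu l}"

text \<open>The length \<open>m\<close> is free in order to serve both the descent to an inner
  corner and the last descent to the axis.\<close>

lemma marginal_down_from_corner:
  assumes k: "k \<in> {1..n}" and lam: "lam k \<in> partitions"
    and marginal: "marginal height (i n) (i k - j k) E Psi"
    and m: "m \<le> j k" "k < n \<Longrightarrow> m \<le> j k - j (Suc k)"
  shows "marginal height (i n) (i k - j k + m)
    (E \<inter> {\<omega> \<in> space M. path_Lam height \<omega> (i k - j k) = lam k})
    (\<lambda>gam. Psi (lam k) * skew_schur (lam k) gam (map a [Suc (j k - m)..<Suc (j k)]))"
proof (rule marginal_down[OF lam])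
  show "marginal height (i n) (i k - j k) (E \<inter> {\<omega> \<in> space M. path_Lam height \<omega> (i k - j k) = lam k})
      (\<lambda>gam. Psi (lam k) * skew_schur (lam k) gam [])"
    by (rule marginal_cong[OF marginal_mark[OF marginal]]) (auto simp: skew_schur_Nil lam)
  have "j k < i k" using below_diagonal k by simp
  moreover have "i k \<le> i n" using i_mono k by simp
  ultimately show "i k - j k + m \<le> i n" using m by simp
  show "height (i k - j k + s) = j k - s" if "s \<le> m" for s
  proof -
    have "height (i k - j k + s) = i k - (i k - j k + s)"
      using k that m \<open>j k < i k\<close> j_decreasing[of k] by (intro height_slope) auto
    then show ?thesis using \<open>j k < i k\<close> by simp
  qed
qed (use m in simp)

text \<open>From one outer corner the path descends to the inner corner, where \<open>mu k\<close>
  is recorded, and moves right to the next outer corner; each of the two pieces yields one factor of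
  the weight.\<close>

lemma marginal_corner:
  assumes "1 \<le> k" "k \<le> n" and lam: "\<And>l. l \<in> {1..n} \<Longrightarrow> lam l \<in> partitions"
    and mu: "\<And>l. l \<in> {1..<n} \<Longrightarrow> mu l \<in> partitions"
  shows "marginal height (i n) (i k - j k) (earlier_event k lam mu) (partial_weight k lam mu)"
  using assms(1,2)
proof (induction k rule: dec_induct)
  case base
  have "j 1 < i 1" using below_diagonal n_pos by simp
  have "i 1 \<le> i n" using i_mono n_pos by simp
  \<comment> \<open>The diagonal edge supplies \<open>[c]\<close>, and the piece from
    \<open>(j 1, j 1)\<close> to \<open>(i 1, j 1)\<close> appends the other variables of
    \<open>LPP_rho_plus c a i j 0\<close>.\<close>
  have "marginal height (i n) (0 + (i 1 - j 1)) (space M)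
      (\<lambda>gam. tau gam ([c] @ map a [Suc (j 1 + 0)..<Suc (j 1 + 0 + (i 1 - j 1))]))"
  proof (rule marginal_left)
    show "marginal height (i n) 0 (space M) (\<lambda>gam. tau gam [c])"
      by (rule marginal_start[OF profile_height])
    show "height (0 + s) = j 1" if "s \<le> i 1 - j 1" for s
      using that n_pos by (intro height_plateau) auto
  qed (use tau_snoc \<open>i 1 \<le> i n\<close> in auto)
  then show ?case
    using \<open>j 1 < i 1\<close>
    by (simp add: partial_weight_def[abs_def] earlier_event_def LPP_rho_plus_def del: upt_Suc)
next
  case (step k)
  then have k: "k \<in> {1..n}" "Suc k \<in> {1..n}" "k < n" by auto
  have ij: "j (Suc k) < j k" "j k < i k" "i k < i (Suc k)" "i (Suc k) \<le> i n" "j (Suc k) < i (Suc k)"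
    using j_decreasing[of k] below_diagonal[of k] i_increasing[of k] i_mono[of "Suc k" n] k
      below_diagonal[of "Suc k"] by auto
  let ?E = "earlier_event k lam mu \<inter> {\<omega> \<in> space M. path_Lam height \<omega> (i k - j k) = lam k}"
  let ?E' = "?E \<inter> {\<omega> \<in> space M. path_Lam height \<omega> (i k - j (Suc k)) = mu k}"
  let ?A = "partial_weight k lam mu (lam k) * skew_schur (lam k) (mu k) (LPP_rho_minus a n j k)"
  have mu_k: "mu k \<in> partitions" and lam_k: "lam k \<in> partitions"
    using mu lam k by auto
  have "marginal height (i n) (i k - j k + (j k - j (Suc k))) ?E
      (\<lambda>gam. partial_weight k lam mu (lam k) * skew_schur (lam k) gam
        (map a [Suc (j k - (j k - j (Suc k)))..<Suc (j k)]))"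
    using step k lam_k by (intro marginal_down_from_corner) auto
  then have "marginal height (i n) (i k - j (Suc k)) ?E
      (\<lambda>gam. partial_weight k lam mu (lam k) * skew_schur (lam k) gam (LPP_rho_minus a n j k))"
    using ij k by (simp add: LPP_rho_minus_def)
  then have "marginal height (i n) (i k - j (Suc k)) ?E' (\<lambda>gam. ?A * skew_schur gam (mu k) [])"
    by (rule marginal_cong[OF marginal_mark]) (auto simp: skew_schur_Nil)
  then have "marginal height (i n) (i k - j (Suc k) + (i (Suc k) - i k)) ?E'
      (\<lambda>gam. ?A * skew_schur gam (mu k) ([] @ map a [Suc (j (Suc k) + (i k - j (Suc k)))..<
        Suc (j (Suc k) + (i k - j (Suc k)) + (i (Suc k) - i k))]))"
  proof (rule marginal_left[rotated])
    show "height (i k - j (Suc k) + s) = j (Suc k)" if "s \<le> i (Suc k) - i k" for s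
      using that k ij by (intro height_plateau) auto
    show "?A * skew_schur gam (mu k) (rho @ [b]) = (\<Sum>beta | beta \<in> partitions \<and> beta \<le> gam.
        ?A * skew_schur beta (mu k) rho * skew_schur gam beta [b])" if "gam \<in> partitions" for gam rho b
      unfolding skew_schur_snoc[OF that mu_k] sum_distrib_left by (simp only: mult.assoc)
  qed (use ij in simp)
  then have "marginal height (i n) (i (Suc k) - j (Suc k)) ?E'
      (\<lambda>gam. ?A * skew_schur gam (mu k) (LPP_rho_plus c a i j k))"
    using ij k by (simp add: LPP_rho_plus_def)
  moreover have "?E' = earlier_event (Suc k) lam mu"
    using k by (auto simp: earlier_event_def less_Suc_eq)
  moreover have "(\<lambda>gam. ?A * skew_schur gam (mu k) (LPP_rho_plus c a i j k)) =
      partial_weight (Suc k) lam mu"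
  proof
    fix gam
    have "(\<Prod>l\<in>{1..<k}. skew_schur (lam l) (mu l) (LPP_rho_minus a n j l) *
        skew_schur ((lam(Suc k := gam)) (Suc l)) (mu l) (LPP_rho_plus c a i j l)) =
      (\<Prod>l\<in>{1..<k}. skew_schur (lam l) (mu l) (LPP_rho_minus a n j l) *
        skew_schur (lam (Suc l)) (mu l) (LPP_rho_plus c a i j l))"
      by (intro prod.cong) auto
    then show "?A * skew_schur gam (mu k) (LPP_rho_plus c a i j k) = partial_weight (Suc k) lam mu gam"
      using k by (simp add: partial_weight_def prod.atLeastLessThan_Suc)
  qed
  ultimately show ?case by simp
qed

lemma prob_PSP:
  assumes lam: "\<And>l. l \<in> {1..n} \<Longrightarrow> lam l \<in> partitions" and mu: "\<And>l. l \<in> {1..<n} \<Longrightarrow> mu l \<in> partitions"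
  defines "E \<equiv> {\<omega> \<in> space M. (\<forall>k\<in>{1..n}. Lam \<omega> (i k) (j k) = lam k) \<and>
    (\<forall>k\<in>{1..<n}. Lam \<omega> (i k) (j (Suc k)) = mu k)}"
  shows "E \<in> events"
    "prob E = norm_const height * PSP_weight n (LPP_rho_plus c a i j) (LPP_rho_minus a n j) (lam, mu)"
proof -
  have n: "n \<in> {1..n}" using n_pos by simp
  have "j n < i n" using below_diagonal n by simp
  let ?E = "earlier_event n lam mu \<inter> {\<omega> \<in> space M. path_Lam height \<omega> (i n - j n) = lam n}"
  \<comment> \<open>The last descent meets the axis at time \<open>i n\<close>, where the partition
    is empty. If \<open>j n = 0\<close>, it has no steps and the factor is the indicator that
    \<open>lam n\<close> is empty.\<close>
  have "marginal height (i n) (i n - j n + j n) ?E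
      (\<lambda>gam. partial_weight n lam mu (lam n) * skew_schur (lam n) gam
        (map a [Suc (j n - j n)..<Suc (j n)]))"
    using n lam by (intro marginal_down_from_corner marginal_corner mu) auto
  then have "marginal height (i n) (i n) ?E
      (\<lambda>gam. partial_weight n lam mu (lam n) * skew_schur (lam n) gam (map a [1..<Suc (j n)]))"
    using \<open>j n < i n\<close> by simp
  note * = marginal_end[OF profile_height this]
  have corner1: "path_Lam height \<omega> (i k - j k) = Lam \<omega> (i k) (j k)" if "k \<in> {1..n}" for k \<omega>
  proof -
    have "height (i k - j k) = i k - (i k - j k)"
      using that j_decreasing[of k] by (intro height_slope) (auto intro!: diff_le_mono2)
    then show ?thesis using that below_diagonal[of k] by (simp add: path_Lam_eq)
  qed
  have corner2: "path_Lam height \<omega> (i k - j (Suc k)) = Lam \<omega> (i k) (j (Suc k))"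
    if "k \<in> {1..<n}" for k \<omega>
  proof -
    have "height (i k - j (Suc k)) = i k - (i k - j (Suc k))"
      using that j_decreasing[of k] by (intro height_slope) (auto intro!: diff_le_mono2)
    then show ?thesis
      using that below_diagonal[of k] j_decreasing[of k] by (simp add: path_Lam_eq)
  qed
  have "?E = E"
    unfolding E_def earlier_event_def using corner1 corner2 n
    by (auto simp: le_less)
  moreover have "partial_weight n lam mu (lam n) * skew_schur (lam n) empty_partition (map a [1..<Suc (j n)]) =
      PSP_weight n (LPP_rho_plus c a i j) (LPP_rho_minus a n j) (lam, mu)"
    by (simp add: partial_weight_def PSP_weight_def LPP_rho_minus_def)
  ultimately show "E \<in> events"
    "prob E = norm_const height * PSP_weight n (LPP_rho_plus c a i j) (LPP_rho_minus a n j) (lam, mu)"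
    using * by simp_all
qed

section \<open>The two equalities in law\<close>

lemma LPP_law_PSP:
  "distr M (\<Pi>\<^sub>M k\<in>{1..n}. count_space UNIV)
      (\<lambda>\<omega>. \<lambda>k\<in>{1..n}. half_space_LPP (\<lambda>v. g v \<omega>) (i k) (j k))
   = distr (PSP n (LPP_rho_plus c a i j) (LPP_rho_minus a n j))
      (\<Pi>\<^sub>M k\<in>{1..n}. count_space UNIV) (\<lambda>(lam, mu). \<lambda>k\<in>{1..n}. lam k 0)"
proof -
  let ?A = "({1..n} \<rightarrow>\<^sub>E partitions) \<times> ({1..<n} \<rightarrow>\<^sub>E partitions)"
  let ?X = "\<lambda>\<omega>. (\<lambda>k\<in>{1..n}. Lam \<omega> (i k) (j k), \<lambda>k\<in>{1..<n}. Lam \<omega> (i k) (j (Suc k)))"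
  let ?N = "\<Pi>\<^sub>M k\<in>{1..n}. count_space (UNIV :: nat set)"
  let ?f = "\<lambda>(lam, mu :: nat \<Rightarrow> nat \<Rightarrow> nat). \<lambda>k\<in>{1..n}. lam k 0 :: nat"
  have le: "j k \<le> i k" if "k \<in> {1..n}" for k
    using that below_diagonal[of k] by simp
  have le': "j (Suc k) \<le> i k" if "k \<in> {1..<n}" for k
    using that below_diagonal[of k] j_decreasing[of k] by simp
  have event: "{\<omega> \<in> space M. ?X \<omega> = x} = {\<omega> \<in> space M. (\<forall>k\<in>{1..n}. Lam \<omega> (i k) (j k) = fst x k) \<and>
      (\<forall>k\<in>{1..<n}. Lam \<omega> (i k) (j (Suc k)) = snd x k)}" if "x \<in> ?A" for x
  proof -
    show ?thesis
      using that by (cases x) (auto simp: restrict_eq_PiE_iff)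
  qed
  have countable: "countable ?A"
    by (intro countable_SIGMA countable_PiE countable_partitions) auto
  have X: "?X \<in> space M \<rightarrow> ?A"
    using le le' growth_properties by (auto simp: Lam_def)
  have X_law: "\<forall>x\<in>?A. {\<omega> \<in> space M. ?X \<omega> = x} \<in> events \<and>
      prob {\<omega> \<in> space M. ?X \<omega> = x} =
        norm_const height * PSP_weight n (LPP_rho_plus c a i j) (LPP_rho_minus a n j) x"
  proof
    fix x assume "x \<in> ?A"
    then show "{\<omega> \<in> space M. ?X \<omega> = x} \<in> events \<and> prob {\<omega> \<in> space M. ?X \<omega> = x} =
        norm_const height * PSP_weight n (LPP_rho_plus c a i j) (LPP_rho_minus a n j) x"
      unfolding event[OF \<open>x \<in> ?A\<close>] using prob_PSP[of "fst x" "snd x"] by (auto simp: PiE_iff)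
  qed
  note law = proportional_measure_eq_distr[OF prob_space_axioms countable X norm_const_pos X_law]
  have f: "?f \<in> count_space ?A \<rightarrow>\<^sub>M ?N"
    by (auto simp: space_PiM)
  have "distr (PSP n (LPP_rho_plus c a i j) (LPP_rho_minus a n j)) ?N ?f = distr M ?N (?f \<circ> ?X)"
    unfolding PSP_def law(2) by (rule distr_distr[OF f law(1)])
  also have "?f \<circ> ?X = (\<lambda>\<omega>. \<lambda>k\<in>{1..n}. half_space_LPP (\<lambda>v. g v \<omega>) (i k) (j k))"
    using le growth_first_row by (auto simp: fun_eq_iff Lam_def)
  finally show ?thesis ..
qed

end

context half_space_model
begin

text \<open>The process records every partition on the path, and the passage times at any family of
  its vertices are first rows of these; hence the arbitrary index set \<open>I\<close>.\<close>

lemma LPP_law_zigzag: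
  assumes p: "p \<in> zigzag_paths" and points: "\<And>k. k \<in> I \<Longrightarrow> (i k, j k) \<in> range p"
  shows "distr M (\<Pi>\<^sub>M k\<in>I. count_space UNIV)
      (\<lambda>\<omega>. \<lambda>k\<in>I. half_space_LPP (\<lambda>v. g v \<omega>) (i k) (j k))
    = distr (zigzag_process p [c] (single_variable_label a))
      (\<Pi>\<^sub>M k\<in>I. count_space UNIV) (\<lambda>Lam. \<lambda>k\<in>I. Lam (i k, j k) 0)"
proof -
  define h where "h t = snd (p t)" for t
  have step: "horizontal_edge (p (Suc t), p t) \<or> vertical_edge (p (Suc t), p t)" for t
    using p by (simp add: zigzag_paths_def)
  have p_eq: "p t = (h t + t, h t)" for t
  proof (induction t)
    case 0
    then show ?case using p by (auto simp: zigzag_paths_def h_def)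
  next
    case (Suc t)
    then show ?case
      using step[of t] by (auto simp: horizontal_edge_def vertical_edge_def h_def prod_eq_iff)
  qed
  have h_step: "h (Suc t) \<le> h t \<and> h t \<le> Suc (h (Suc t))" for t
    using step[of t] by (auto simp: horizontal_edge_def vertical_edge_def h_def)
  obtain L where "h L = 0"
    using p by (auto simp: zigzag_paths_def h_def)
  have "h t = 0" if "L \<le> t" for t
    using that
  proof (induction t rule: dec_induct)
    case (step t)
    then show ?case using h_step[of t] by simp
  qed fact
  then have profile: "profile h L"
    using h_step by (simp add: profile_def)
  have inj: "inj p"
    by (auto simp: inj_def p_eq)
  let ?A = "{x \<in> range p \<rightarrow>\<^sub>E partitions. \<forall>v\<in>range p. snd v = 0 \<longrightarrow> x v = empty_partition}"
  let ?X = "\<lambda>\<omega>. \<lambda>v\<in>range p. Lam \<omega> (fst v) (snd v)"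
  let ?N = "\<Pi>\<^sub>M k\<in>I. count_space (UNIV :: nat set)"
  let ?f = "\<lambda>x :: nat \<times> nat \<Rightarrow> nat \<Rightarrow> nat. \<lambda>k\<in>I. x (i k, j k) 0"
  have A: "x (p t) \<in> partitions" "t \<ge> L \<Longrightarrow> x (p t) = empty_partition" if "x \<in> ?A" for x t
    using that profile by (auto simp: PiE_iff profile_def p_eq)
  have event: "{\<omega> \<in> space M. ?X \<omega> = x} = {\<omega> \<in> space M. path_Lam h \<omega> = (\<lambda>t. x (p t))}"
    if "x \<in> ?A" for x
  proof -
    have "?X \<omega> = x \<longleftrightarrow> (\<forall>v\<in>range p. Lam \<omega> (fst v) (snd v) = x v)" for \<omega>
      using that by (intro restrict_eq_PiE_iff[of _ _ "\<lambda>_. partitions"]) blast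
    also have "\<dots> \<omega> \<longleftrightarrow> path_Lam h \<omega> = (\<lambda>t. x (p t))" for \<omega>
      by (auto simp: fun_eq_iff path_Lam_eq p_eq)
    finally show ?thesis by blast
  qed
  \<comment> \<open>From time \<open>L\<close> on the vertices lie on the axis, so a configuration
    is determined by its first \<open>L\<close> partitions.\<close>
  have countable: "countable ?A"
  proof (rule countable_image_inj_on)
    let ?F = "\<lambda>x. map (\<lambda>t. x (p t)) [0..<L]"
    show "countable (?F ` ?A)"
      by (rule countable_subset[OF _ countable_lists[OF countable_partitions]]) (use A(1) in auto)
    show "inj_on ?F ?A"
    proof (rule inj_onI)
      fix x y assume xy: "x \<in> ?A" "y \<in> ?A" "?F x = ?F y"
      have "x (p t) = y (p t)" for t
        using xy A(2)[OF xy(1), of t] A(2)[OF xy(2), of t] by (cases "t < L") auto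
      then show "x = y"
        using xy(1,2) by (intro PiE_ext[of x "range p" "\<lambda>_. partitions" y]) auto
    qed
  qed
  have weight: "zigzag_weight p [c] (single_variable_label a) x = path_weight c a h L (\<lambda>t. x (p t))"
    if "x \<in> ?A" for x
  proof -
    let ?w = "\<lambda>t. step_weight a h t (x (p t)) (x (p (Suc t)))" and ?e = "\<lambda>t. (p (Suc t), p t)"
    have edge: "edge_weight (single_variable_label a) x (?e t) = ?w t" for t
      using h_step[of t]
      by (auto simp: edge_weight_def single_variable_label_def horizontal_edge_def step_weight_def p_eq)
    \<comment> \<open>\<open>L\<close> need not be the first time on the axis; the axis steps before
      it are absent from the product over edges and must contribute \<open>1\<close> to the path
      weight.\<close>
    have trivial: "?w t = 1" if "h t = 0" for t
    proof -
      have "h (Suc t) = 0" using h_step[of t] that by simp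
      then have "x (p t) = empty_partition" "x (p (Suc t)) = empty_partition"
        using \<open>x \<in> ?A\<close> that by (simp_all add: p_eq)
      then show ?thesis
        using that \<open>h (Suc t) = 0\<close> by (simp add: step_weight_def skew_schur_empty)
    qed
    have "{e \<in> path_edges p. snd (snd e) > 0} = ?e ` {t. h t > 0}"
      by (auto simp: path_edges_def p_eq)
    moreover have "inj_on ?e {t. h t > 0}"
      using inj by (auto simp: inj_on_def)
    ultimately have "(\<Prod>e\<in>{e \<in> path_edges p. snd (snd e) > 0}. edge_weight (single_variable_label a) x e) =
        (\<Prod>t | h t > 0. ?w t)"
      by (simp add: prod.reindex edge)
    also have "\<dots> = (\<Prod>t<L. ?w t)"
      using profile trivial by (intro prod.mono_neutral_left) (auto simp: profile_def not_less[symmetric])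
    finally show ?thesis
      by (simp add: zigzag_weight_def path_weight_def)
  qed
  have X: "?X \<in> space M \<rightarrow> ?A"
  proof (rule funcsetI)
    fix \<omega>
    have "Lam \<omega> (fst (p t)) (snd (p t)) \<in> partitions" for t
      using growth_properties[of "h t" "h t + t"] by (simp add: Lam_def p_eq)
    then show "?X \<omega> \<in> ?A"
      by (auto simp: Lam_def)
  qed
  have X_law: "\<forall>x\<in>?A. {\<omega> \<in> space M. ?X \<omega> = x} \<in> events \<and>
      prob {\<omega> \<in> space M. ?X \<omega> = x} =
        norm_const h * zigzag_weight p [c] (single_variable_label a) x"
  proof
    fix x assume x: "x \<in> ?A"
    show "{\<omega> \<in> space M. ?X \<omega> = x} \<in> events \<and> prob {\<omega> \<in> space M. ?X \<omega> = x} =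
        norm_const h * zigzag_weight p [c] (single_variable_label a) x"
      unfolding event[OF x] weight[OF x]
      by (intro conjI prob_path[OF profile] A[OF x])
  qed
  note law = proportional_measure_eq_distr[OF prob_space_axioms countable X norm_const_pos X_law]
  have f: "?f \<in> count_space ?A \<rightarrow>\<^sub>M ?N"
    by (auto simp: space_PiM)
  have "distr (zigzag_process p [c] (single_variable_label a)) ?N ?f = distr M ?N (?f \<circ> ?X)"
    unfolding zigzag_process_def law(2) by (rule distr_distr[OF f law(1)])
  also have "?f \<circ> ?X = (\<lambda>\<omega>. \<lambda>k\<in>I. half_space_LPP (\<lambda>v. g v \<omega>) (i k) (j k))"
  proof -
    have "j k \<le> i k" if "k \<in> I" for k
      using points[OF that] by (auto simp: p_eq)
    then show ?thesis
      using points growth_first_row by (auto simp: fun_eq_iff Lam_def)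
  qed
  finally show ?thesis ..
qed

end

theorem proposition3p10:
  fixes M :: "'w measure"
    and g :: "nat \<times> nat \<Rightarrow> 'w \<Rightarrow> nat"
    and c :: real and a :: "nat \<Rightarrow> real"
    and n :: nat and i j :: "nat \<Rightarrow> nat"
  assumes c_pos: "c > 0"
    and a_pos: "\<And>k. k \<ge> 1 \<Longrightarrow> a k > 0"
    and ca_less: "\<And>k. k \<ge> 1 \<Longrightarrow> c * a k < 1"
    and aa_less: "\<And>k l. k \<ge> 1 \<Longrightarrow> l \<ge> 1 \<Longrightarrow> k \<noteq> l \<Longrightarrow> a k * a l < 1"
    and prob: "prob_space M"
    and indep: "prob_space.indep_vars M (\<lambda>_. count_space UNIV) g {(x, y). 1 \<le> y \<and> y \<le> x}"
    and law_off_diagonal: "\<And>x y. 1 \<le> y \<Longrightarrow> y < x \<Longrightarrow>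
          distr M (count_space UNIV) (g (x, y)) = measure_pmf (Geom (a x * a y))"
    and law_diagonal: "\<And>x. 1 \<le> x \<Longrightarrow>
          distr M (count_space UNIV) (g (x, x)) = measure_pmf (Geom (c * a x))"
    and n_pos: "n \<ge> 1"
    and i_pos: "0 < i 1"
    and i_increasing: "\<And>k. 1 \<le> k \<Longrightarrow> k < n \<Longrightarrow> i k < i (Suc k)"
    and j_decreasing: "\<And>k. 1 \<le> k \<Longrightarrow> k < n \<Longrightarrow> j k > j (Suc k)"
    and below_diagonal: "\<And>k. 1 \<le> k \<Longrightarrow> k \<le> n \<Longrightarrow> i k > j k"
  shows
    "distr M (\<Pi>\<^sub>M k\<in>{1..n}. count_space UNIV)
        (\<lambda>\<omega>. \<lambda>k\<in>{1..n}. half_space_LPP (\<lambda>v. g v \<omega>) (i k) (j k))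
     = distr (PSP n (LPP_rho_plus c a i j) (LPP_rho_minus a n j))
        (\<Pi>\<^sub>M k\<in>{1..n}. count_space UNIV)
        (\<lambda>(lam, mu). \<lambda>k\<in>{1..n}. lam k 0)
     \<and>
     (\<forall>p\<in>zigzag_paths. (\<forall>k\<in>{1..n}. (i k, j k) \<in> range p) \<longrightarrow>
        distr M (\<Pi>\<^sub>M k\<in>{1..n}. count_space UNIV)
          (\<lambda>\<omega>. \<lambda>k\<in>{1..n}. half_space_LPP (\<lambda>v. g v \<omega>) (i k) (j k))
        = distr (zigzag_process p [c] (single_variable_label a))
          (\<Pi>\<^sub>M k\<in>{1..n}. count_space UNIV)
          (\<lambda>Lam. \<lambda>k\<in>{1..n}. Lam (i k, j k) 0))"
proof -
  interpret half_space_model M g c a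
    by (rule half_space_model.intro[OF prob], rule half_space_model_axioms.intro, rule c_pos,
        erule a_pos, erule ca_less, erule (2) aa_less, rule indep,
        erule (1) law_off_diagonal, erule law_diagonal)
  interpret half_space_points M g c a n i j
    by unfold_locales (use n_pos i_increasing j_decreasing below_diagonal in auto)
  show ?thesis
  proof (intro conjI ballI impI)
    fix p assume "p \<in> zigzag_paths" "\<forall>k\<in>{1..n}. (i k, j k) \<in> range p"
    then show "distr M (\<Pi>\<^sub>M k\<in>{1..n}. count_space UNIV)
          (\<lambda>\<omega>. \<lambda>k\<in>{1..n}. half_space_LPP (\<lambda>v. g v \<omega>) (i k) (j k))
        = distr (zigzag_process p [c] (single_variable_label a))
          (\<Pi>\<^sub>M k\<in>{1..n}. count_space UNIV)
          (\<lambda>Lam. \<lambda>k\<in>{1..n}. Lam (i k, j k) 0)"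
      by (intro LPP_law_zigzag) blast+
  qed (rule LPP_law_PSP)
qed

end
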